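(* Let $\nu>0$, $\lambda>0$, $\alpha\ge 0$. Let $F\in C(\mathbb R,\mathbb R)$ be Lipschitz continuous on bounded sets with $F(0)=0$, and suppose that $$(x_1-x_2)(F(x_1)-F(x_2))\le -\alpha|x_1-x_2|^2\qquad\text{for all }x_1,x_2\in\mathbb R.$$ If $f\in C(\mathbb R,\ell_2)$ is almost automorphic (respectively, recurrent), then the equation $$u'=\nu\Lambda u-\lambda u+\widetilde F(u)+f(t)$$ in $\ell_2$ has a unique almost automorphic (respectively, recurrent) solution $u:\mathbb R\to\ell_2$, and this solution is globally exponentially stable.
   Context: $\ell_2$ is the Hilbert space of real two-sided square-summable sequences $(\xi_i)_{i\in\mathbb Z}$ with $\langle\xi,\eta\rangle=\sum_{i\in\mathbb Z}\xi_i\eta_i$ and norm $\|\xi\|^2=\langle\xi,\xi\rangle$. The discrete Laplacian $\Lambda:\ell_2\to\ell_2$ is $(\Lambda u)_i=u_{i-1}-2u_i+u_{i+1}$. The Nemytskii operator $\widetilde F:\ell_2\to\ell_2$ is $\widetilde F(\xi)_i=F(\xi_i)$ (well defined because $F$ is locally Lipschitz and $F(0)=0$). A (two-sided) dynamical system $(X,\mathbb R,\pi)$ on a complete metric space $(X,\rho)$ is a continuous map $\pi:\mathbb R\times X\to X$ with $\pi(0,x)=x$ and $\pi(s,\pi(t,x))=\pi(s+t,x)$. A set $A\subset\mathbb R$ is relatively dense if there is $l>0$ with $A\cap[a,a+l]\ne\emptyset$ for all $a\in\mathbb R$. A point $x\in X$ is: - (Bohr) almost periodic if for every $\varepsilon>0$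 the set $\{\tau\in\mathbb R:\rho(\pi(t+\tau,x),\pi(t,x))<\varepsilon\ \forall t\in\mathbb R\}$ is relatively dense; - almost recurrent if for every $\varepsilon>0$ the set $\{\tau\in\mathbb R:\rho(\pi(\tau,x),x)<\varepsilon\}$ is relatively dense; - recurrent if it is almost recurrent and its trajectory $\pi(\mathbb R,x)$ is precompact; - Levitan almost periodic if there exist a dynamical system $(Y,\mathbb R,\sigma)$ on a complete metric space and an almost periodic point $y\in Y$ with $\mathfrak N_y\subseteq\mathfrak N_x$, where $\mathfrak N_x$ is the set of sequences $\{t_n\}\subset\mathbb R$ with $\pi(t_n,x)\to x$; - almost automorphic if it is Levitan almost periodic and Lagrange stable (i.e. its trajectory is precompact). A function $f\in C(\mathbb R,\ell_2)$ is almost automorphic (respectively, recurrent) if it is an almost automorphic (respectively, recurrent) point of the shift dynamical system $(C(\mathbb R,\ell_2),\mathbb R,\sigma)$, where $\sigma(h,f)(t)=f(t+h)$ and $C(\mathbb R,\ell_2)$ carries the complete metric $d(f_1,f_2)=\sup_{L>0}\min\{\max_{|t|\le L}\|f_1(t)-f_2(t)\|,L^{-1}\}$, which generates the compact-open topology. A solution $u$ on $\mathbb R$ is globally exponentially stable if there are constants $N,\kappa>0$ such that for every $v\in\ell_2$ the solution $\varphi(t,v,f)$ of the equation with $\varphi(0,v,f)=v$ satisfies $\|\varphi(t,v,f)-u(t)\|\le Ne^{-\kappa t}\|v-u(0)\|$ for all $t\ge0$. *)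

theory Defs
  imports "HOL-Analysis.Analysis"
begin

section \<open>The Hilbert space of two-sided square-summable real sequences\<close>

typedef ell2 = "{x :: int \<Rightarrow> real. (\<lambda>i. (x i)\<^sup>2) summable_on UNIV}"
  morphisms coord Abs_ell2
  by (rule exI[of _ "\<lambda>_. 0"]) simp

setup_lifting type_definition_ell2

lemma square_summable_add:
  fixes x y :: "int \<Rightarrow> real"
  assumes "(\<lambda>i. (x i)\<^sup>2) summable_on UNIV" "(\<lambda>i. (y i)\<^sup>2) summable_on UNIV"
  shows "(\<lambda>i. (x i + y i)\<^sup>2) summable_on UNIV"
proof (rule summable_on_comparison_test)
  show "(\<lambda>i. 2 * (x i)\<^sup>2 + 2 * (y i)\<^sup>2) summable_on UNIV"
    by (intro summable_on_add summable_on_cmult_right assms)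
  show "(x i + y i)\<^sup>2 \<le> 2 * (x i)\<^sup>2 + 2 * (y i)\<^sup>2" for i
    using zero_le_power2[of "x i - y i"] by (simp add: power2_eq_square algebra_simps)
qed simp

lemma square_summable_scale:
  fixes x :: "int \<Rightarrow> real"
  assumes "(\<lambda>i. (x i)\<^sup>2) summable_on UNIV"
  shows "(\<lambda>i. (c * x i)\<^sup>2) summable_on UNIV"
  unfolding power_mult_distrib by (intro summable_on_cmult_right assms)

lemma square_summable_mult:
  fixes x y :: "int \<Rightarrow> real"
  assumes "(\<lambda>i. (x i)\<^sup>2) summable_on UNIV" "(\<lambda>i. (y i)\<^sup>2) summable_on UNIV"
  shows "(\<lambda>i. x i * y i) summable_on UNIV"
proof -
  have "(\<lambda>i. (1/2) * ((x i + y i)\<^sup>2 + (-1) * ((x i)\<^sup>2 + (y i)\<^sup>2))) summable_on UNIV"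
    by (intro summable_on_cmult_right summable_on_add square_summable_add assms)
  moreover have "(1/2) * ((x i + y i)\<^sup>2 + (-1) * ((x i)\<^sup>2 + (y i)\<^sup>2)) = x i * y i" for i
    by (simp add: power2_eq_square algebra_simps)
  ultimately show ?thesis by simp
qed

instantiation ell2 :: real_vector
begin

lift_definition zero_ell2 :: ell2 is "\<lambda>_. 0" by simp

lift_definition plus_ell2 :: "ell2 \<Rightarrow> ell2 \<Rightarrow> ell2" is "\<lambda>x y i. x i + y i"
  by (rule square_summable_add)

lift_definition uminus_ell2 :: "ell2 \<Rightarrow> ell2" is "\<lambda>x i. - x i"
  by simp

lift_definition minus_ell2 :: "ell2 \<Rightarrow> ell2 \<Rightarrow> ell2" is "\<lambda>x y i. x i - y i"
  using square_summable_add[of _ "\<lambda>i. - _ i"] by simp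

lift_definition scaleR_ell2 :: "real \<Rightarrow> ell2 \<Rightarrow> ell2" is "\<lambda>c x i. c * x i"
  by (rule square_summable_scale)

instance
  by standard (transfer; simp add: algebra_simps)+

end

instantiation ell2 :: real_inner
begin

lift_definition inner_ell2 :: "ell2 \<Rightarrow> ell2 \<Rightarrow> real" is "\<lambda>x y. \<Sum>\<^sub>\<infinity>i\<in>UNIV. x i * y i" .

definition norm_ell2 :: "ell2 \<Rightarrow> real" where "norm_ell2 x = sqrt (inner x x)"
definition dist_ell2 :: "ell2 \<Rightarrow> ell2 \<Rightarrow> real" where "dist_ell2 x y = norm (x - y)"
definition sgn_ell2 :: "ell2 \<Rightarrow> ell2" where "sgn_ell2 x = inverse (norm x) *\<^sub>R x"
definition uniformity_ell2 :: "(ell2 \<times> ell2) filter" where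
  "uniformity_ell2 = (INF e\<in>{0<..}. principal {(x, y). dist x y < e})"
definition open_ell2 :: "ell2 set \<Rightarrow> bool" where
  "open_ell2 U = (\<forall>x\<in>U. \<forall>\<^sub>F (x', y) in uniformity. x' = x \<longrightarrow> y \<in> U)"

instance
proof
  fix x y z :: ell2 and r :: real
  show "inner x y = inner y x"
    by transfer (simp add: mult.commute)
  show "inner (x + y) z = inner x z + inner y z"
    by transfer (simp add: distrib_right infsum_add square_summable_mult)
  show "inner (r *\<^sub>R x) y = r * inner x y"
    by transfer (simp add: mult.assoc infsum_cmult_right')
  show "0 \<le> inner x x"
    by transfer (simp add: infsum_nonneg)
  show "inner x x = 0 \<longleftrightarrow> x = 0"
  proof
    assume "inner x x = 0"
    then show "x = 0"
    proof transfer
      fix x :: "int \<Rightarrow> real"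
      assume *: "(\<lambda>i. (x i)\<^sup>2) summable_on UNIV" "(\<Sum>\<^sub>\<infinity>i. x i * x i) = 0"
      have "(x i)\<^sup>2 = 0" for i
        by (rule nonneg_infsum_le_0D[of "\<lambda>i. (x i)\<^sup>2" UNIV])
          (use * in \<open>auto simp: power2_eq_square\<close>)
      then show "x = (\<lambda>_. 0)" by auto
    qed
  next
    assume "x = 0"
    then show "inner x x = 0" by (simp; transfer; simp)
  qed
qed (simp_all add: norm_ell2_def dist_ell2_def sgn_ell2_def uniformity_ell2_def open_ell2_def)

end

lemma coord_add: "coord (x + y) i = coord x i + coord y i"
  by transfer simp

lemma coord_diff: "coord (x - y) i = coord x i - coord y i"
  by transfer simp

lemma coord_scaleR: "coord (c *\<^sub>R x) i = c * coord x i"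
  by transfer simp

lemma norm_ell2_square: "(norm x)\<^sup>2 = (\<Sum>\<^sub>\<infinity>i. (coord x i)\<^sup>2)"
  unfolding power2_norm_eq_inner by transfer (simp add: power2_eq_square)

lemma sum_coord_le_norm:
  assumes "finite S"
  shows "(\<Sum>i\<in>S. (coord x i)\<^sup>2) \<le> (norm x)\<^sup>2"
  unfolding norm_ell2_square using coord[of x] assms
  by (intro finite_sum_le_infsum) auto

lemma abs_coord_le_norm: "\<bar>coord x i\<bar> \<le> norm x"
  using sum_coord_le_norm[of "{i}" x] by (simp add: abs_le_square_iff[symmetric])

instance ell2 :: banach
proof
  fix X :: "nat \<Rightarrow> ell2"
  assume X: "Cauchy X"
  have "Cauchy (\<lambda>n. coord (X n) i)" for i
  proof (rule metric_CauchyI)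
    fix e :: real assume "e > 0"
    then obtain N where "\<forall>m\<ge>N. \<forall>n\<ge>N. dist (X m) (X n) < e"
      using X unfolding Cauchy_def by blast
    moreover have "dist (coord (X m) i) (coord (X n) i) \<le> dist (X m) (X n)" for m n
      using abs_coord_le_norm[of "X m - X n" i] by (simp add: dist_norm coord_diff)
    ultimately show "\<exists>N. \<forall>m\<ge>N. \<forall>n\<ge>N. dist (coord (X m) i) (coord (X n) i) < e"
      by (meson order_le_less_trans)
  qed
  then have "\<exists>l. (\<lambda>n. coord (X n) i) \<longlonglongrightarrow> l" for i
    using Cauchy_convergent unfolding convergent_def by blast
  then obtain l where l: "\<And>i. (\<lambda>n. coord (X n) i) \<longlonglongrightarrow> l i" by metis
  have fin: "\<exists>N. \<forall>n\<ge>N. \<forall>S. finite S \<longrightarrow> (\<Sum>i\<in>S. (l i - coord (X n) i)\<^sup>2) \<le> e\<^sup>2"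
    if "e > 0" for e :: real
  proof -
    obtain N where N: "\<And>m n. m \<ge> N \<Longrightarrow> n \<ge> N \<Longrightarrow> norm (X m - X n) < e"
      using X \<open>e > 0\<close> unfolding Cauchy_iff by blast
    have "(\<Sum>i\<in>S. (l i - coord (X n) i)\<^sup>2) \<le> e\<^sup>2" if "n \<ge> N" "finite S" for n S
    proof (rule LIMSEQ_le_const2)
      show "(\<lambda>m. \<Sum>i\<in>S. (coord (X m) i - coord (X n) i)\<^sup>2) \<longlonglongrightarrow>
          (\<Sum>i\<in>S. (l i - coord (X n) i)\<^sup>2)"
        by (intro tendsto_intros l)
      have "(\<Sum>i\<in>S. (coord (X m) i - coord (X n) i)\<^sup>2) \<le> e\<^sup>2" if "m \<ge> N" for m
      proof -
        have "(\<Sum>i\<in>S. (coord (X m) i - coord (X n) i)\<^sup>2) \<le> (norm (X m - X n))\<^sup>2"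
          using sum_coord_le_norm[OF \<open>finite S\<close>, of "X m - X n"] by (simp add: coord_diff)
        also have "\<dots> \<le> e\<^sup>2"
          using N[OF \<open>m \<ge> N\<close> \<open>n \<ge> N\<close>] by (intro power_mono) auto
        finally show ?thesis .
      qed
      then show "\<exists>M. \<forall>m\<ge>M. (\<Sum>i\<in>S. (coord (X m) i - coord (X n) i)\<^sup>2) \<le> e\<^sup>2" by blast
    qed
    then show ?thesis by blast
  qed
  have summ: "(\<lambda>i. (l i - coord (X n) i)\<^sup>2) summable_on UNIV"
    if "\<forall>S. finite S \<longrightarrow> (\<Sum>i\<in>S. (l i - coord (X n) i)\<^sup>2) \<le> e\<^sup>2" for n and e :: real
    by (rule nonneg_bdd_above_summable_on) (use that in \<open>auto intro!: bdd_aboveI[of _ "e\<^sup>2"]\<close>)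
  obtain N1 where N1: "\<forall>S. finite S \<longrightarrow> (\<Sum>i\<in>S. (l i - coord (X N1) i)\<^sup>2) \<le> 1\<^sup>2"
    using fin[OF zero_less_one] by blast
  have "(\<lambda>i. (l i)\<^sup>2) summable_on UNIV"
    using square_summable_add[OF summ[OF N1], of "coord (X N1)"] coord[of "X N1"] by simp
  then obtain L where L: "coord L = l"
    using Abs_ell2_inverse by blast
  have "X \<longlonglongrightarrow> L"
  proof (rule metric_LIMSEQ_I)
    fix e :: real assume "e > 0"
    then obtain N where N: "\<And>n S. n \<ge> N \<Longrightarrow> finite S \<Longrightarrow> (\<Sum>i\<in>S. (l i - coord (X n) i)\<^sup>2) \<le> (e/2)\<^sup>2"
      using fin[of "e/2"] by auto
    have "dist (X n) L < e" if "n \<ge> N" for n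
    proof -
      have "(norm (L - X n))\<^sup>2 \<le> (e/2)\<^sup>2"
        unfolding norm_ell2_square coord_diff L
        by (rule infsum_le_finite_sums) (use N[OF that] summ[of n "e / 2"] in blast)+
      then have "norm (L - X n) \<le> e/2"
        using \<open>e > 0\<close> by (auto intro: power2_le_imp_le[of _ "e / 2"])
      then show ?thesis using \<open>e > 0\<close> by (simp add: dist_norm norm_minus_commute[of "X n" L])
    qed
    then show "\<exists>N. \<forall>n\<ge>N. dist (X n) L < e" by blast
  qed
  then show "convergent X" by (auto simp: convergent_def)
qed


section \<open>Dynamical systems and Poisson stable motions\<close>

locale dynamical_system = Metric_space M d for M :: "'a set" and d +
  fixes \<pi> :: "real \<Rightarrow> 'a \<Rightarrow> 'a"
  assumes complete: mcomplete
    and continuous: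
      "continuous_map (prod_topology euclideanreal mtopology) mtopology (\<lambda>(t, x). \<pi> t x)"
    and flow_zero: "x \<in> M \<Longrightarrow> \<pi> 0 x = x"
    and flow_add: "x \<in> M \<Longrightarrow> \<pi> s (\<pi> t x) = \<pi> (s + t) x"

definition relatively_dense :: "real set \<Rightarrow> bool" where
  "relatively_dense A \<longleftrightarrow> (\<exists>l>0. \<forall>a. A \<inter> {a..a + l} \<noteq> {})"

context dynamical_system
begin

definition trajectory :: "'a \<Rightarrow> 'a set" where
  "trajectory x = range (\<lambda>t. \<pi> t x)"

definition lagrange_stable :: "'a \<Rightarrow> bool" where
  "lagrange_stable x \<longleftrightarrow> x \<in> M \<and> compactin mtopology (mtopology closure_of (trajectory x))"

definition almost_periodic :: "'a \<Rightarrow> bool" where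
  "almost_periodic x \<longleftrightarrow> x \<in> M \<and>
    (\<forall>\<epsilon>>0. relatively_dense {\<tau>. \<forall>t. d (\<pi> (t + \<tau>) x) (\<pi> t x) < \<epsilon>})"

definition almost_recurrent :: "'a \<Rightarrow> bool" where
  "almost_recurrent x \<longleftrightarrow> x \<in> M \<and> (\<forall>\<epsilon>>0. relatively_dense {\<tau>. d (\<pi> \<tau> x) x < \<epsilon>})"

definition recurrent :: "'a \<Rightarrow> bool" where
  "recurrent x \<longleftrightarrow> almost_recurrent x \<and> lagrange_stable x"

definition return_sequences :: "'a \<Rightarrow> (nat \<Rightarrow> real) set" where
  "return_sequences x = {t. limitin mtopology (\<lambda>n. \<pi> (t n) x) x sequentially}"

text \<open>
  The auxiliary system \<open>(Y, \<sigma>)\<close> ranges over all complete metric spaces. HOL cannot quantify over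
  types inside a definition, so its carrier is an arbitrary set of functions from reals to reals
  with an arbitrary metric. This is no restriction: by the lemma
  \<open>levitan_almost_periodic_any_carrier\<close> below, a witness \<open>(Y, \<sigma>)\<close> carried by any type whatsoever
  can be replaced by one of this form.
\<close>

definition levitan_almost_periodic :: "'a \<Rightarrow> bool" where
  "levitan_almost_periodic x \<longleftrightarrow> x \<in> M \<and>
    (\<exists>(Y :: (real \<Rightarrow> real) set) dY \<sigma> y.
      dynamical_system Y dY \<sigma> \<and>
      dynamical_system.almost_periodic Y dY \<sigma> y \<and>
      dynamical_system.return_sequences Y dY \<sigma> y \<subseteq> return_sequences x)"

definition almost_automorphic :: "'a \<Rightarrow> bool" where
  "almost_automorphic x \<longleftrightarrow> levitan_almost_periodic x \<and> lagrange_stable x"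

end

lemma (in Metric_space) continuous_map_flow_iff:
  assumes "\<And>t x. x \<in> M \<Longrightarrow> \<pi> t x \<in> M"
  shows "continuous_map (prod_topology euclideanreal mtopology) mtopology (\<lambda>(t, x). \<pi> t x) \<longleftrightarrow>
    (\<forall>t. \<forall>x\<in>M. \<forall>\<epsilon>>0. \<exists>\<delta>>0. \<forall>s. \<forall>y\<in>M. \<bar>s - t\<bar> < \<delta> \<and> d x y < \<delta> \<longrightarrow> d (\<pi> t x) (\<pi> s y) < \<epsilon>)"
    (is "?L \<longleftrightarrow> ?R")
proof
  assume L: ?L
  show ?R
  proof (intro allI ballI impI)
    fix t x and \<epsilon> :: real assume "x \<in> M" "\<epsilon> > 0"
    let ?W = "{p \<in> topspace (prod_topology euclideanreal mtopology).
        (\<lambda>(t, x). \<pi> t x) p \<in> mball (\<pi> t x) \<epsilon>}"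
    have W: "openin (prod_topology euclideanreal mtopology) ?W"
      by (rule openin_continuous_map_preimage[OF L]) simp
    have "(t, x) \<in> ?W" using \<open>x \<in> M\<close> \<open>\<epsilon> > 0\<close> assms by auto
    then obtain U V where U: "open U" "t \<in> U" and V: "openin mtopology V" "x \<in> V"
      and UV: "U \<times> V \<subseteq> ?W"
      using W[unfolded openin_prod_topology_alt, rule_format, of t x] by auto
    obtain \<delta>1 where \<delta>1: "\<delta>1 > 0" "\<And>s. \<bar>s - t\<bar> < \<delta>1 \<Longrightarrow> s \<in> U"
      using U unfolding open_dist by (metis dist_real_def)
    obtain \<delta>2 where \<delta>2: "\<delta>2 > 0" "mball x \<delta>2 \<subseteq> V"
      using V unfolding openin_mtopology by blast
    show "\<exists>\<delta>>0. \<forall>s. \<forall>y\<in>M. \<bar>s - t\<bar> < \<delta> \<and> d x y < \<delta> \<longrightarrow> d (\<pi> t x) (\<pi> s y) < \<epsilon>"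
    proof (intro exI[of _ "min \<delta>1 \<delta>2"] conjI allI ballI impI)
      fix s y assume "y \<in> M" and *: "\<bar>s - t\<bar> < min \<delta>1 \<delta>2 \<and> d x y < min \<delta>1 \<delta>2"
      then have "(s, y) \<in> U \<times> V" using \<delta>1 \<delta>2 \<open>x \<in> M\<close> by auto
      then show "d (\<pi> t x) (\<pi> s y) < \<epsilon>" using UV by auto
    qed (use \<delta>1 \<delta>2 in auto)
  qed
next
  assume R: ?R
  show ?L
    unfolding continuous_map_def
  proof (intro conjI allI impI)
    show "(\<lambda>(t, x). \<pi> t x) \<in> topspace (prod_topology euclideanreal mtopology) \<rightarrow> topspace mtopology"
      using assms by auto
    fix U assume U: "openin mtopology U"
    show "openin (prod_topology euclideanreal mtopology)
        {p \<in> topspace (prod_topology euclideanreal mtopology). (\<lambda>(t, x). \<pi> t x) p \<in> U}"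
      unfolding openin_prod_topology_alt
    proof (intro allI impI)
      fix t x
      assume "(t, x) \<in> {p \<in> topspace (prod_topology euclideanreal mtopology). (\<lambda>(t, x). \<pi> t x) p \<in> U}"
      then have x: "x \<in> M" "\<pi> t x \<in> U" by auto
      then obtain \<epsilon> where \<epsilon>: "\<epsilon> > 0" "mball (\<pi> t x) \<epsilon> \<subseteq> U"
        using U unfolding openin_mtopology by blast
      then obtain \<delta> where \<delta>: "\<delta> > 0"
        "\<And>s y. y \<in> M \<Longrightarrow> \<bar>s - t\<bar> < \<delta> \<Longrightarrow> d x y < \<delta> \<Longrightarrow> d (\<pi> t x) (\<pi> s y) < \<epsilon>"
        using R x by meson
      have sub: "ball t \<delta> \<times> mball x \<delta> \<subseteq>
          {p \<in> topspace (prod_topology euclideanreal mtopology). (\<lambda>(t, x). \<pi> t x) p \<in> U}"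
      proof
        fix p assume "p \<in> ball t \<delta> \<times> mball x \<delta>"
        then obtain s y where p: "p = (s, y)" "\<bar>s - t\<bar> < \<delta>" "y \<in> M" "d x y < \<delta>"
          by (auto simp: dist_real_def abs_minus_commute)
        then have "\<pi> s y \<in> mball (\<pi> t x) \<epsilon>" using \<delta> assms x by auto
        then show "p \<in> {p \<in> topspace (prod_topology euclideanreal mtopology). (\<lambda>(t, x). \<pi> t x) p \<in> U}"
          using p \<epsilon> by auto
      qed
      show "\<exists>Ua V. openin euclideanreal Ua \<and> openin mtopology V \<and> t \<in> Ua \<and> x \<in> V \<and> Ua \<times> V \<subseteq>
          {p \<in> topspace (prod_topology euclideanreal mtopology). (\<lambda>(t, x). \<pi> t x) p \<in> U}"
        by (intro exI[of _ "ball t \<delta>"] exI[of _ "mball x \<delta>"] conjI sub)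
          (use x \<delta> in auto)
    qed
  qed
qed

context dynamical_system
begin

lemma flow_in: "x \<in> M \<Longrightarrow> \<pi> t x \<in> M"
  using continuous_map_image_subset_topspace[OF continuous] by fastforce

lemma flow_continuousD:
  assumes "x \<in> M" "\<epsilon> > 0"
  obtains \<delta> where "\<delta> > 0"
    "\<And>s y. y \<in> M \<Longrightarrow> \<bar>s - t\<bar> < \<delta> \<Longrightarrow> d x y < \<delta> \<Longrightarrow> d (\<pi> t x) (\<pi> s y) < \<epsilon>"
proof -
  have "\<exists>\<delta>>0. \<forall>s. \<forall>y\<in>M. \<bar>s - t\<bar> < \<delta> \<and> d x y < \<delta> \<longrightarrow> d (\<pi> t x) (\<pi> s y) < \<epsilon>"
    using iffD1[OF continuous_map_flow_iff continuous, rule_format, OF flow_in assms, of t]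
    by simp
  then show ?thesis using that by blast
qed

text \<open>
  The orbit closure \<open>H\<close> of a point \<open>y\<close> is a complete invariant set, and a point of \<open>H\<close> is determined
  by its distances to the points of the orbit; this embeds \<open>H\<close> into the functions from reals to reals.
\<close>

lemma orbit_closure_transfer:
  assumes y: "y \<in> M"
  obtains Y :: "(real \<Rightarrow> real) set" and dY \<sigma> y' where
    "dynamical_system Y dY \<sigma>" "y' \<in> Y"
    "\<And>s t. dY (\<sigma> s y') (\<sigma> t y') = d (\<pi> s y) (\<pi> t y)"
proof -
  define H where "H = mtopology closure_of (trajectory y)"
  define g where "g = (\<lambda>x t. d x (\<pi> t y))"
  define Y where "Y = g ` H"
  define h where "h = inv_into H g"
  define dY where "dY = (\<lambda>a b. d (h a) (h b))"
  define \<sigma> where "\<sigma> = (\<lambda>t a. g (\<pi> t (h a)))"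
  have HM: "H \<subseteq> M" unfolding H_def using closure_of_subset_topspace[of mtopology] by simp
  have H_iff: "x \<in> H \<longleftrightarrow> x \<in> M \<and> (\<forall>r>0. \<exists>t. d x (\<pi> t y) < r)" for x
    unfolding H_def metric_closure_of trajectory_def by (auto simp: flow_in y)
  have inv: "\<pi> t x \<in> H" if x: "x \<in> H" for t x
    unfolding H_iff
  proof (intro conjI allI impI)
    show "\<pi> t x \<in> M" using x HM flow_in by auto
    fix r :: real assume "r > 0"
    then obtain \<delta> where \<delta>: "\<delta> > 0"
      "\<And>s z. z \<in> M \<Longrightarrow> \<bar>s - t\<bar> < \<delta> \<Longrightarrow> d x z < \<delta> \<Longrightarrow> d (\<pi> t x) (\<pi> s z) < r"
      using flow_continuousD[of x r t] x HM by blast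
    obtain s where "d x (\<pi> s y) < \<delta>" using x \<delta> H_iff by blast
    then have "d (\<pi> t x) (\<pi> t (\<pi> s y)) < r" using \<delta> flow_in y by simp
    then show "\<exists>s. d (\<pi> t x) (\<pi> s y) < r" using flow_add y by auto
  qed
  have yH: "y \<in> H" unfolding H_iff using y flow_zero[OF y] by (metis mdist_zero)
  have inj: "inj_on g H"
  proof (rule inj_onI, rule ccontr)
    fix a b assume ab: "a \<in> H" "b \<in> H" "g a = g b" "a \<noteq> b"
    then have M: "a \<in> M" "b \<in> M" using HM by auto
    then have pos: "d a b > 0" using \<open>a \<noteq> b\<close> mdist_pos_less by blast
    obtain t where t: "d a (\<pi> t y) < d a b / 2"
      using ab(1) pos unfolding H_iff by (meson half_gt_zero)
    moreover have "d b (\<pi> t y) = d a (\<pi> t y)" using fun_cong[OF ab(3), of t] by (simp add: g_def)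
    moreover have "d a b \<le> d a (\<pi> t y) + d b (\<pi> t y)" using triangle' M flow_in y by blast
    ultimately show False by simp
  qed
  have hg: "h (g x) = x" if "x \<in> H" for x using inj that by (simp add: h_def)
  have hH: "h a \<in> H" and gh: "g (h a) = a" if "a \<in> Y" for a
    using that by (auto simp: Y_def hg)
  interpret sub: Submetric M d H by unfold_locales (rule HM)
  have subc: "sub.sub.mcomplete"
    unfolding sub.sub.mcomplete_def
  proof (intro allI impI)
    fix z assume z: "sub.sub.MCauchy z"
    then have "MCauchy z" "range z \<subseteq> H" using HM unfolding sub.sub.MCauchy_def MCauchy_def by auto
    then obtain x where x: "limitin mtopology z x sequentially"
      using complete mcomplete_def by blast
    moreover have "x \<in> H"
      using limitin_closedin[OF x, of H] \<open>range z \<subseteq> H\<close>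
      unfolding H_def by (simp add: image_subset_iff)
    ultimately show "\<exists>x. limitin sub.sub.mtopology z x sequentially"
      using \<open>range z \<subseteq> H\<close> unfolding sub.limitin_submetric_iff
      by (intro exI[of _ x]) (auto simp: image_subset_iff)
  qed
  interpret Y: Metric_space Y dY
  proof
    fix a b c
    show "0 \<le> dY a b" "dY a b = dY b a" by (simp_all add: dY_def commute)
    { assume "a \<in> Y" "b \<in> Y"
      then show "dY a b = 0 \<longleftrightarrow> a = b" using hH gh HM unfolding dY_def by (metis subsetD zero) }
    { assume "a \<in> Y" "b \<in> Y" "c \<in> Y"
      then show "dY a c \<le> dY a b + dY b c" using hH HM unfolding dY_def by (blast intro: triangle) }
  qed
  have \<sigma>Y: "\<sigma> t a \<in> Y" if "a \<in> Y" for t a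
    using inv hH[OF that] by (auto simp: \<sigma>_def Y_def)
  have h\<sigma>: "h (\<sigma> t a) = \<pi> t (h a)" if "a \<in> Y" for t a
    unfolding \<sigma>_def by (rule hg) (rule inv, rule hH, rule that)
  have ds: "dynamical_system Y dY \<sigma>"
  proof
    show "Y.mcomplete"
      unfolding Y.mcomplete_def
    proof (intro allI impI)
      fix z assume z: "Y.MCauchy z"
      then have zY: "z n \<in> Y" for n unfolding Y.MCauchy_def by auto
      have "sub.sub.MCauchy (\<lambda>n. h (z n))"
        using z[unfolded Y.MCauchy_def] zY hH by (auto simp: sub.sub.MCauchy_def dY_def)
      then obtain x where "limitin sub.sub.mtopology (\<lambda>n. h (z n)) x sequentially"
        using subc sub.sub.mcomplete_def by blast
      then have x: "x \<in> H" "\<And>e. e > 0 \<Longrightarrow> \<exists>N. \<forall>n\<ge>N. d (h (z n)) x < e"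
        unfolding sub.sub.limit_metric_sequentially by blast+
      have "g x \<in> Y" using x(1) by (simp add: Y_def)
      then have "limitin Y.mtopology z (g x) sequentially"
        unfolding Y.limit_metric_sequentially unfolding dY_def hg[OF x(1)] using zY x(2) by blast
      then show "\<exists>x. limitin Y.mtopology z x sequentially" by blast
    qed
    show "continuous_map (prod_topology euclideanreal Y.mtopology) Y.mtopology (\<lambda>(t, x). \<sigma> t x)"
    proof (rule Y.continuous_map_flow_iff[of \<sigma>, OF \<sigma>Y, THEN iffD2], assumption, intro allI ballI impI)
      fix t a and \<epsilon> :: real assume a: "a \<in> Y" "\<epsilon> > 0"
      then have "h a \<in> M" using hH HM by blast
      then obtain \<delta> where \<delta>: "\<delta> > 0"
        "\<And>s z. z \<in> M \<Longrightarrow> \<bar>s - t\<bar> < \<delta> \<Longrightarrow> d (h a) z < \<delta> \<Longrightarrow> d (\<pi> t (h a)) (\<pi> s z) < \<epsilon>"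
        using flow_continuousD a by blast
      show "\<exists>\<delta>>0. \<forall>s. \<forall>b\<in>Y. \<bar>s - t\<bar> < \<delta> \<and> dY a b < \<delta> \<longrightarrow> dY (\<sigma> t a) (\<sigma> s b) < \<epsilon>"
        using \<delta> a hH HM by (intro exI[of _ \<delta>]) (auto simp: dY_def h\<sigma>)
    qed
    fix a s t assume a: "a \<in> Y"
    then have hM: "h a \<in> M" using hH HM by blast
    show "\<sigma> 0 a = a" using flow_zero[OF hM] gh[OF a] by (simp add: \<sigma>_def)
    show "\<sigma> s (\<sigma> t a) = \<sigma> (s + t) a"
      using flow_add[OF hM] h\<sigma>[OF a] by (simp add: \<sigma>_def)
  qed
  have gY: "g y \<in> Y" using yH by (simp add: Y_def)
  have eq: "dY (\<sigma> s (g y)) (\<sigma> t (g y)) = d (\<pi> s y) (\<pi> t y)" for s t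
    unfolding dY_def h\<sigma>[OF gY] hg[OF yH] ..
  show ?thesis by (rule that[of Y dY \<sigma> "g y", OF ds gY eq])
qed

lemma levitan_almost_periodic_any_carrier:
  fixes Y :: "'b set" and dY \<sigma> y
  assumes x: "x \<in> M"
    and Y: "dynamical_system Y dY \<sigma>" "dynamical_system.almost_periodic Y dY \<sigma> y"
      "dynamical_system.return_sequences Y dY \<sigma> y \<subseteq> return_sequences x"
  shows "levitan_almost_periodic x"
proof -
  interpret Y: dynamical_system Y dY \<sigma> by (rule Y(1))
  have yY: "y \<in> Y" using Y(2) by (simp add: Y.almost_periodic_def)
  then obtain Z :: "(real \<Rightarrow> real) set" and dZ \<rho> z where
    Z: "dynamical_system Z dZ \<rho>" "z \<in> Z"
      "\<And>s t. dZ (\<rho> s z) (\<rho> t z) = dY (\<sigma> s y) (\<sigma> t y)"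
    using Y.orbit_closure_transfer by blast
  interpret Z: dynamical_system Z dZ \<rho> by (rule Z(1))
  have Z0: "dZ (\<rho> s z) z = dY (\<sigma> s y) y" for s
    using Z(3)[of s 0] Z.flow_zero[OF Z(2)] Y.flow_zero[OF yY] by simp
  have "Z.almost_periodic z"
    using Y(2) Z(2) by (simp add: Z.almost_periodic_def Y.almost_periodic_def Z(3))
  moreover have "Z.return_sequences z = Y.return_sequences y"
    unfolding Z.return_sequences_def Y.return_sequences_def
      Z.limit_metric_sequentially Y.limit_metric_sequentially Z0
    using Z(2) yY Z.flow_in Y.flow_in by auto
  ultimately show ?thesis
    unfolding levitan_almost_periodic_def using x Z(1) Y(3) by metis
qed

end


section \<open>The shift dynamical system\<close>

definition continuous_functions :: "(real \<Rightarrow> 'a::topological_space) set" where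
  "continuous_functions = {f. continuous_on UNIV f}"

text \<open>
  The value 0 outside the carrier is a dummy; it is there because \<^locale>\<open>Metric_space\<close> asks for
  nonnegativity on the whole type. For continuous functions the inner supremum is a maximum.
\<close>

definition compact_open_dist :: "(real \<Rightarrow> 'a::real_normed_vector) \<Rightarrow> (real \<Rightarrow> 'a) \<Rightarrow> real" where
  "compact_open_dist f g =
    (if f \<in> continuous_functions \<and> g \<in> continuous_functions
     then SUP L\<in>{0<..}. min (SUP t\<in>{-L..L}. norm (f t - g t)) (1 / L) else 0)"

definition shift :: "real \<Rightarrow> (real \<Rightarrow> 'a) \<Rightarrow> real \<Rightarrow> 'a" where
  "shift h f = (\<lambda>t. f (t + h))"

lemma compact_open_dist_eq:
  assumes "continuous_on UNIV f" "continuous_on UNIV g"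
  shows "compact_open_dist f g = (SUP L\<in>{0<..}. min (SUP t\<in>{-L..L}. norm (f t - g t)) (1 / L))"
  using assms by (simp add: compact_open_dist_def continuous_functions_def)

lemma bdd_above_norm_diff:
  fixes f g :: "real \<Rightarrow> 'a::real_normed_vector"
  assumes "continuous_on UNIV f" "continuous_on UNIV g"
  shows "bdd_above ((\<lambda>t. norm (f t - g t)) ` {-L..L})"
proof -
  have "continuous_on {-L..L} (\<lambda>t. norm (f t - g t))"
    by (intro continuous_intros) (use assms in \<open>auto intro: continuous_on_subset\<close>)
  then have "compact ((\<lambda>t. norm (f t - g t)) ` {-L..L})"
    by (rule compact_continuous_image) simp
  then show ?thesis
    by (intro bounded_imp_bdd_above compact_imp_bounded)
qed

lemma bdd_above_compact_open_dist:
  fixes f g :: "real \<Rightarrow> 'a::real_normed_vector"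
  assumes "continuous_on UNIV f" "continuous_on UNIV g"
  shows "bdd_above ((\<lambda>L. min (SUP t\<in>{-L..L}. norm (f t - g t)) (1 / L)) ` {0<..})"
proof (rule bdd_aboveI2)
  fix L :: real assume L: "L \<in> {0<..}"
  show "min (SUP t\<in>{-L..L}. norm (f t - g t)) (1 / L) \<le> max (SUP t\<in>{-1..1}. norm (f t - g t)) 1"
  proof (cases "L \<le> 1")
    case True
    then have "(SUP t\<in>{-L..L}. norm (f t - g t)) \<le> (SUP t\<in>{-1..1}. norm (f t - g t))"
      using L by (intro cSUP_subset_mono bdd_above_norm_diff assms) auto
    then show ?thesis by linarith
  next
    case False
    then have "1 / L \<le> 1" by (simp add: divide_le_eq)
    then show ?thesis by linarith
  qed
qed

lemma compact_open_dist_leI: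
  fixes f g :: "real \<Rightarrow> 'a::real_normed_vector"
  assumes "continuous_on UNIV f" "continuous_on UNIV g"
    and "e > 0" "\<And>t. \<bar>t\<bar> \<le> 1 / e \<Longrightarrow> norm (f t - g t) \<le> e"
  shows "compact_open_dist f g \<le> e"
  unfolding compact_open_dist_eq[OF assms(1,2)]
proof (rule cSUP_least)
  fix L :: real assume "L \<in> {0<..}"
  then have L: "L > 0" by simp
  show "min (SUP t\<in>{-L..L}. norm (f t - g t)) (1 / L) \<le> e"
  proof (cases "L \<le> 1 / e")
    case True
    then have "(SUP t\<in>{-L..L}. norm (f t - g t)) \<le> e"
      using L by (intro cSUP_least assms(4)) auto
    then show ?thesis by simp
  next
    case False
    then have "1 / L \<le> e" using L \<open>e > 0\<close> by (simp add: field_simps)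
    then show ?thesis by simp
  qed
qed auto

lemma compact_open_dist_lessD:
  fixes f g :: "real \<Rightarrow> 'a::real_normed_vector"
  assumes "continuous_on UNIV f" "continuous_on UNIV g"
    and "compact_open_dist f g < e" "e > 0" "\<bar>t\<bar> \<le> 1 / e"
  shows "norm (f t - g t) < e"
proof -
  have "min (SUP t\<in>{-(1/e)..1/e}. norm (f t - g t)) (1 / (1/e)) \<le> compact_open_dist f g"
    unfolding compact_open_dist_eq[OF assms(1,2)]
    by (rule cSUP_upper) (use assms bdd_above_compact_open_dist[OF assms(1,2)] in auto)
  then have "(SUP t\<in>{-(1/e)..1/e}. norm (f t - g t)) < e"
    using assms by simp
  moreover have "norm (f t - g t) \<le> (SUP t\<in>{-(1/e)..1/e}. norm (f t - g t))"
    by (rule cSUP_upper) (use assms bdd_above_norm_diff[OF assms(1,2)] in auto)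
  ultimately show ?thesis by simp
qed

lemma compact_open_dist_nonneg: "0 \<le> compact_open_dist f g"
proof (cases "f \<in> continuous_functions \<and> g \<in> continuous_functions")
  case True
  then have fg: "continuous_on UNIV f" "continuous_on UNIV g"
    by (auto simp: continuous_functions_def)
  have "norm (f 0 - g 0) \<le> (SUP t\<in>{-1..1}. norm (f t - g t))"
    by (rule cSUP_upper) (use bdd_above_norm_diff[OF fg] in auto)
  then have "0 \<le> (SUP t\<in>{-1..1}. norm (f t - g t))"
    using norm_ge_zero order_trans by blast
  then have "0 \<le> min (SUP t\<in>{-1..1}. norm (f t - g t)) (1 / 1)" by simp
  also have "\<dots> \<le> compact_open_dist f g"
    unfolding compact_open_dist_eq[OF fg]
    by (rule cSUP_upper) (use bdd_above_compact_open_dist[OF fg] in auto)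
  finally show ?thesis .
qed (auto simp: compact_open_dist_def)

interpretation compact_open: Metric_space
  "continuous_functions :: (real \<Rightarrow> 'a::real_normed_vector) set" compact_open_dist
proof
  fix f g h :: "real \<Rightarrow> 'a"
  show "0 \<le> compact_open_dist f g" by (rule compact_open_dist_nonneg)
  show "compact_open_dist f g = compact_open_dist g f"
    by (auto simp: compact_open_dist_def norm_minus_commute)
  { assume "f \<in> continuous_functions" "g \<in> continuous_functions"
    then have fg: "continuous_on UNIV f" "continuous_on UNIV g"
      by (auto simp: continuous_functions_def)
    show "compact_open_dist f g = 0 \<longleftrightarrow> f = g"
    proof
      assume 0: "compact_open_dist f g = 0"
      have "f t = g t" for t
      proof (rule ccontr)
        assume "f t \<noteq> g t"
        define e where "e = min (norm (f t - g t)) (1 / (\<bar>t\<bar> + 1))"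
        have e: "e > 0" using \<open>f t \<noteq> g t\<close> by (simp add: e_def)
        have "e \<le> 1 / (\<bar>t\<bar> + 1)" by (simp add: e_def)
        then have "\<bar>t\<bar> \<le> 1 / e" using e by (simp add: field_simps)
        then have "norm (f t - g t) < e"
          using compact_open_dist_lessD[OF fg, of e] e 0 by simp
        then show False by (simp add: e_def)
      qed
      then show "f = g" by blast
    next
      assume "f = g"
      then have "compact_open_dist f g \<le> e" if "e > 0" for e
        using compact_open_dist_leI[OF fg that] that by simp
      then have "compact_open_dist f g \<le> 0"
        by (meson dense_ge)
      then show "compact_open_dist f g = 0"
        using compact_open_dist_nonneg[of f g] by simp
    qed
  }
  { assume "f \<in> continuous_functions" "g \<in> continuous_functions" "h \<in> continuous_functions"
    then have c: "continuous_on UNIV f" "continuous_on UNIV g" "continuous_on UNIV h"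
      by (auto simp: continuous_functions_def)
    show "compact_open_dist f h \<le> compact_open_dist f g + compact_open_dist g h"
    proof (rule field_le_epsilon)
      fix e :: real assume "e > 0"
      define a where "a = compact_open_dist f g + e / 2"
      define b where "b = compact_open_dist g h + e / 2"
      have a: "a > 0" "compact_open_dist f g < a" and b: "b > 0" "compact_open_dist g h < b"
        using compact_open_dist_nonneg[of f g] compact_open_dist_nonneg[of g h] \<open>e > 0\<close>
        by (auto simp: a_def b_def)
      have "compact_open_dist f h \<le> a + b"
      proof (rule compact_open_dist_leI[OF c(1,3)])
        fix t assume t: "\<bar>t\<bar> \<le> 1 / (a + b)"
        have "1 / (a + b) \<le> 1 / a" "1 / (a + b) \<le> 1 / b"
          using a b by (auto intro: divide_left_mono)
        then have "norm (f t - g t) < a" "norm (g t - h t) < b"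
          using compact_open_dist_lessD[OF c(1,2) a(2,1)] compact_open_dist_lessD[OF c(2,3) b(2,1)] t
          by auto
        then show "norm (f t - h t) \<le> a + b"
          using norm_triangle_ineq[of "f t - g t" "g t - h t"] by simp
      qed (use a b in simp)
      then show "compact_open_dist f h \<le> compact_open_dist f g + compact_open_dist g h + e"
        by (simp add: a_def b_def)
    qed
  }
qed

lemma compact_open_mcomplete:
  "Metric_space.mcomplete (continuous_functions :: (real \<Rightarrow> 'a::banach) set) compact_open_dist"
  unfolding compact_open.mcomplete_def
proof (intro allI impI)
  fix X :: "nat \<Rightarrow> real \<Rightarrow> 'a"
  assume X: "compact_open.MCauchy X"
  then have c: "continuous_on UNIV (X n)" for n
    unfolding compact_open.MCauchy_def by (auto simp: continuous_functions_def)
  have ex: "\<exists>N. \<forall>m\<ge>N. \<forall>n\<ge>N. \<forall>t. \<bar>t\<bar> \<le> 1 / e \<longrightarrow> norm (X m t - X n t) < e"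
    if "e > 0" for e :: real
    using X that compact_open_dist_lessD[OF c c] unfolding compact_open.MCauchy_def by meson
  have "Cauchy (\<lambda>n. X n t)" for t
    unfolding Cauchy_iff
  proof (intro allI impI)
    fix e :: real assume "e > 0"
    define e' where "e' = min e (1 / (\<bar>t\<bar> + 1))"
    have e': "e' > 0" using \<open>e > 0\<close> by (simp add: e'_def)
    have "e' \<le> 1 / (\<bar>t\<bar> + 1)" by (simp add: e'_def)
    then have "\<bar>t\<bar> \<le> 1 / e'" using e' by (simp add: field_simps)
    moreover have "e' \<le> e" by (simp add: e'_def)
    ultimately show "\<exists>M. \<forall>m\<ge>M. \<forall>n\<ge>M. norm (X m t - X n t) < e"
      using ex[OF e'] by (meson order_less_le_trans)
  qed
  then have "\<exists>l. (\<lambda>n. X n t) \<longlonglongrightarrow> l" for t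
    using Cauchy_convergent unfolding convergent_def by blast
  then obtain g where g: "\<And>t. (\<lambda>n. X n t) \<longlonglongrightarrow> g t" by metis
  have lim: "\<exists>N. \<forall>n\<ge>N. \<forall>t. \<bar>t\<bar> \<le> 1 / e \<longrightarrow> norm (X n t - g t) \<le> e"
    if e: "e > 0" for e :: real
  proof -
    obtain N where N: "\<And>m n t. m \<ge> N \<Longrightarrow> n \<ge> N \<Longrightarrow> \<bar>t\<bar> \<le> 1 / e \<Longrightarrow> norm (X m t - X n t) < e"
      using ex[OF e] by blast
    have "norm (X n t - g t) \<le> e" if n: "n \<ge> N" and t: "\<bar>t\<bar> \<le> 1 / e" for n t
    proof (rule LIMSEQ_le_const2)
      show "(\<lambda>m. norm (X n t - X m t)) \<longlonglongrightarrow> norm (X n t - g t)"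
        by (intro tendsto_intros g)
      show "\<exists>M. \<forall>m\<ge>M. norm (X n t - X m t) \<le> e"
        using N[OF n _ t] by (meson less_imp_le)
    qed
    then show ?thesis by blast
  qed
  have gc: "continuous_on UNIV g"
  proof -
    have "continuous_on {-L..L} g" for L
    proof (rule uniform_limit_theorem)
      show "\<forall>\<^sub>F n in sequentially. continuous_on {-L..L} (X n)"
        by (intro always_eventually allI continuous_on_subset[OF c]) auto
      show "uniform_limit {-L..L} X g sequentially"
        unfolding uniform_limit_sequentially_iff
      proof (intro allI impI)
        fix e :: real assume "e > 0"
        define e' where "e' = min (e / 2) (1 / (\<bar>L\<bar> + 1))"
        have e': "e' > 0" "e' < e" using \<open>e > 0\<close> by (auto simp: e'_def)
        have "e' \<le> 1 / (\<bar>L\<bar> + 1)" by (simp add: e'_def)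
        then have "\<bar>L\<bar> \<le> 1 / e'" using e' by (simp add: field_simps)
        then have "\<bar>t\<bar> \<le> 1 / e'" if "t \<in> {-L..L}" for t using that by auto
        then show "\<exists>N. \<forall>n\<ge>N. \<forall>t\<in>{-L..L}. dist (X n t) (g t) < e"
          using lim[OF e'(1)] e'(2) unfolding dist_norm by (meson order_le_less_trans)
      qed
    qed simp
    then have "continuous (at t) g" for t
      by (rule continuous_on_interior[of "{-(\<bar>t\<bar> + 1)..\<bar>t\<bar> + 1}"])
        (auto simp: interior_atLeastAtMost_real)
    then show ?thesis by (simp add: continuous_on_eq_continuous_at)
  qed
  have "limitin compact_open.mtopology X g sequentially"
    unfolding compact_open.limit_metric_sequentially
  proof (intro conjI allI impI)
    show "g \<in> continuous_functions" using gc by (simp add: continuous_functions_def)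
    fix e :: real assume "e > 0"
    then obtain N where "\<forall>n\<ge>N. \<forall>t. \<bar>t\<bar> \<le> 1 / (e/2) \<longrightarrow> norm (X n t - g t) \<le> e/2"
      using lim[of "e/2"] by auto
    then have "\<forall>n\<ge>N. compact_open_dist (X n) g \<le> e/2"
      using compact_open_dist_leI[OF c gc, of "e/2"] \<open>e > 0\<close> by simp
    then show "\<exists>N. \<forall>n\<ge>N. X n \<in> continuous_functions \<and> compact_open_dist (X n) g < e"
      using c \<open>e > 0\<close> by (intro exI[of _ N]) (force simp: continuous_functions_def)
  qed
  then show "\<exists>g. limitin compact_open.mtopology X g sequentially" by blast
qed

interpretation shift_system: dynamical_system
  "continuous_functions :: (real \<Rightarrow> 'a::banach) set" compact_open_dist shift
proof
  show "compact_open.mcomplete TYPE('a)" by (rule compact_open_mcomplete)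
  have sc: "continuous_on UNIV (shift h f)" if "continuous_on UNIV f" for h and f :: "real \<Rightarrow> 'a"
    unfolding shift_def by (intro continuous_on_compose2[OF that] continuous_intros) auto
  have sc': "shift h f \<in> continuous_functions" if "f \<in> continuous_functions"
    for h and f :: "real \<Rightarrow> 'a"
    using sc that by (simp add: continuous_functions_def)
  show "continuous_map (prod_topology euclideanreal compact_open.mtopology)
      (compact_open.mtopology :: (real \<Rightarrow> 'a) topology) (\<lambda>(t, x). shift t x)"
  proof (rule compact_open.continuous_map_flow_iff[of shift, OF sc', THEN iffD2], assumption, intro allI ballI impI)
    fix h and f :: "real \<Rightarrow> 'a" and \<epsilon> :: real
    assume "f \<in> continuous_functions" and \<epsilon>: "\<epsilon> > 0"
    then have f: "continuous_on UNIV f" by (simp add: continuous_functions_def)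
    define K where "K = 2 / \<epsilon> + \<bar>h\<bar> + 1"
    have K: "K > 0" using \<epsilon> by (simp add: K_def add_pos_nonneg add_nonneg_pos)
    have "uniformly_continuous_on {-K..K} f"
      by (intro compact_uniformly_continuous continuous_on_subset[OF f]) auto
    then obtain \<delta>1 where \<delta>1: "\<delta>1 > 0"
      "\<And>s t. s \<in> {-K..K} \<Longrightarrow> t \<in> {-K..K} \<Longrightarrow> dist s t < \<delta>1 \<Longrightarrow> dist (f s) (f t) < \<epsilon> / 4"
      using \<epsilon> unfolding uniformly_continuous_on_def by (metis divide_pos_pos zero_less_numeral)
    define \<delta>2 where "\<delta>2 = min (\<epsilon> / 4) (1 / K)"
    have \<delta>2: "\<delta>2 > 0" "\<delta>2 \<le> \<epsilon> / 4" using \<epsilon> K by (auto simp: \<delta>2_def)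
    have "\<delta>2 \<le> 1 / K" by (simp add: \<delta>2_def)
    then have K\<delta>: "K \<le> 1 / \<delta>2" using \<delta>2 K by (simp add: field_simps)
    show "\<exists>\<delta>>0. \<forall>k. \<forall>g\<in>continuous_functions. \<bar>k - h\<bar> < \<delta> \<and> compact_open_dist f g < \<delta> \<longrightarrow>
        compact_open_dist (shift h f) (shift k g) < \<epsilon>"
    proof (intro exI[of _ "min 1 (min \<delta>1 \<delta>2)"] conjI allI ballI impI)
      fix k and g :: "real \<Rightarrow> 'a"
      assume "g \<in> continuous_functions"
        and *: "\<bar>k - h\<bar> < min 1 (min \<delta>1 \<delta>2) \<and> compact_open_dist f g < min 1 (min \<delta>1 \<delta>2)"
      then have g: "continuous_on UNIV g" by (simp add: continuous_functions_def)
      have "compact_open_dist (shift h f) (shift k g) \<le> \<epsilon> / 2"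
      proof (rule compact_open_dist_leI[OF sc[OF f] sc[OF g]])
        fix t assume "\<bar>t\<bar> \<le> 1 / (\<epsilon> / 2)"
        then have t: "\<bar>t\<bar> \<le> 2 / \<epsilon>" by simp
        have in_K: "t + h \<in> {-K..K}" "t + k \<in> {-K..K}"
          using t * unfolding K_def by auto
        have "dist (f (t + h)) (f (t + k)) < \<epsilon> / 4"
          by (rule \<delta>1(2)[OF in_K]) (use * in \<open>auto simp: dist_real_def\<close>)
        moreover have "norm (f (t + k) - g (t + k)) < \<delta>2"
          by (rule compact_open_dist_lessD[OF f g]) (use * \<delta>2 in_K K\<delta> in auto)
        ultimately show "norm (shift h f t - shift k g t) \<le> \<epsilon> / 2"
          using \<delta>2 norm_triangle_ineq[of "f (t + h) - f (t + k)" "f (t + k) - g (t + k)"]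
          by (simp add: shift_def dist_norm)
      qed (use \<epsilon> in simp)
      then show "compact_open_dist (shift h f) (shift k g) < \<epsilon>" using \<epsilon> by simp
    qed (use \<delta>1 \<delta>2 in auto)
  qed
qed (simp_all add: shift_def ac_simps)

abbreviation almost_automorphic_function :: "(real \<Rightarrow> 'a::banach) \<Rightarrow> bool" where
  "almost_automorphic_function \<equiv> shift_system.almost_automorphic"

abbreviation recurrent_function :: "(real \<Rightarrow> 'a::banach) \<Rightarrow> bool" where
  "recurrent_function \<equiv> shift_system.recurrent"


section \<open>The lattice equation\<close>

lift_definition laplacian :: "ell2 \<Rightarrow> ell2" is "\<lambda>u i. u (i - 1) - 2 * u i + u (i + 1)"
proof -
  fix u :: "int \<Rightarrow> real" assume u: "(\<lambda>i. (u i)\<^sup>2) summable_on UNIV"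
  have shift: "(\<lambda>i. (u (i + k))\<^sup>2) summable_on UNIV" for k
    using summable_on_reindex_bij_betw[of "\<lambda>i. i + k" UNIV UNIV "\<lambda>i. (u i)\<^sup>2"] u
    by (simp add: bij_plus_right)
  show "(\<lambda>i. (u (i - 1) - 2 * u i + u (i + 1))\<^sup>2) summable_on UNIV"
    using square_summable_add[OF square_summable_add[OF shift[of "-1"]
        square_summable_scale[OF u, of "-2"]] shift[of 1]] by simp
qed

text \<open>
  The underlying sequence is square summable under the hypotheses of \<open>coord_nemytskii\<close>; for other
  \<open>F\<close> the value is unspecified.
\<close>

definition nemytskii :: "(real \<Rightarrow> real) \<Rightarrow> ell2 \<Rightarrow> ell2" where
  "nemytskii F \<xi> = Abs_ell2 (\<lambda>i. F (coord \<xi> i))"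

definition lipschitz_on_bounded_sets :: "(real \<Rightarrow> real) \<Rightarrow> bool" where
  "lipschitz_on_bounded_sets F \<longleftrightarrow> (\<forall>B. bounded B \<longrightarrow> (\<exists>L. L-lipschitz_on B F))"

lemma coord_nemytskii:
  assumes "lipschitz_on_bounded_sets F" "F 0 = 0"
  shows "coord (nemytskii F \<xi>) i = F (coord \<xi> i)"
proof -
  obtain L where L: "L-lipschitz_on {-norm \<xi>..norm \<xi>} F"
    using assms(1) unfolding lipschitz_on_bounded_sets_def by (meson bounded_closed_interval)
  have bound: "(F (coord \<xi> j))\<^sup>2 \<le> (L * coord \<xi> j)\<^sup>2" for j
  proof -
    have "dist (F (coord \<xi> j)) (F 0) \<le> L * dist (coord \<xi> j) 0"
      by (rule lipschitz_onD[OF L]) (use abs_coord_le_norm[of \<xi> j] in auto)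
    then have "\<bar>F (coord \<xi> j)\<bar> \<le> \<bar>L * coord \<xi> j\<bar>"
      using assms(2) lipschitz_on_nonneg[OF L] by (simp add: dist_real_def abs_mult)
    then show ?thesis by (simp add: abs_le_square_iff)
  qed
  have "(\<lambda>j. (F (coord \<xi> j))\<^sup>2) summable_on UNIV"
    by (rule summable_on_comparison_test[OF square_summable_scale[of "coord \<xi>" L]])
      (use coord[of \<xi>] bound in auto)
  then show ?thesis by (simp add: nemytskii_def Abs_ell2_inverse)
qed

definition lattice_solution_on ::
    "real set \<Rightarrow> real \<Rightarrow> real \<Rightarrow> (real \<Rightarrow> real) \<Rightarrow> (real \<Rightarrow> ell2) \<Rightarrow> (real \<Rightarrow> ell2) \<Rightarrow> bool" where
  "lattice_solution_on I \<nu> lam F f u \<longleftrightarrow>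
    (\<forall>t\<in>I. (u has_vector_derivative
      \<nu> *\<^sub>R laplacian (u t) - lam *\<^sub>R u t + nemytskii F (u t) + f t) (at t within I))"

abbreviation lattice_solution ::
    "real \<Rightarrow> real \<Rightarrow> (real \<Rightarrow> real) \<Rightarrow> (real \<Rightarrow> ell2) \<Rightarrow> (real \<Rightarrow> ell2) \<Rightarrow> bool" where
  "lattice_solution \<equiv> lattice_solution_on UNIV"

text \<open>
  In the definition below \<open>\<phi>\<close> is the solution \<open>\<phi>(\<cdot>, v, f)\<close> of the initial value problem; since it is
  a total function in HOL, its uniqueness is asserted on the half line only.
\<close>

definition globally_exponentially_stable ::
    "real \<Rightarrow> real \<Rightarrow> (real \<Rightarrow> real) \<Rightarrow> (real \<Rightarrow> ell2) \<Rightarrow> (real \<Rightarrow> ell2) \<Rightarrow> bool" where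
  "globally_exponentially_stable \<nu> lam F f u \<longleftrightarrow>
    (\<exists>N>0. \<exists>\<kappa>>0. \<forall>v. \<exists>\<phi>.
      lattice_solution_on {0..} \<nu> lam F f \<phi> \<and> \<phi> 0 = v \<and>
      (\<forall>\<psi>. lattice_solution_on {0..} \<nu> lam F f \<psi> \<and> \<psi> 0 = v \<longrightarrow> (\<forall>t\<ge>0. \<psi> t = \<phi> t)) \<and>
      (\<forall>t\<ge>0. norm (\<phi> t - u t) \<le> N * exp (- \<kappa> * t) * norm (v - u 0)))"

end

theory Submission
  imports Defs
begin

text \<open>
  Since the Laplacian is nonpositive and \<open>F\<close> is decreasing, the right-hand side is a dissipative
  vector field: the squared distance of two solutions with forcings \<open>\<eta>\<close>-close to each other satisfies
  \<open>q' \<le> - lam q + \<eta>\<^sup>2 / lam\<close>. Hence the solutions starting from 0 at time \<open>-n\<close> converge to a bounded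
  solution \<open>u\<close> on the whole line, which attracts all others and is the only bounded one. Applied to
  two shifts of \<open>u\<close>, the same inequality shows that closeness of two shifts of \<open>f\<close> forces closeness
  of the corresponding shifts of \<open>u\<close>; therefore return times, return sequences and total boundedness
  of the orbit pass from \<open>f\<close> to \<open>u\<close>.
\<close>

section \<open>Ordinary differential equations with Lipschitz right-hand side\<close>

lemma integral_has_vector_derivative_Ici:
  fixes g :: "real \<Rightarrow> 'a::banach"
  assumes "continuous_on {a..} g" "a \<le> t"
  shows "((\<lambda>t. integral {a..t} g) has_vector_derivative g t) (at t within {a..})"
proof -
  have "((\<lambda>t. integral {a..t} g) has_vector_derivative g t) (at t within {a..t + 1})"
    by (rule integral_has_vector_derivative) (use assms in \<open>auto intro: continuous_on_subset\<close>)
  \<comment> \<open>Only points near \<open>t\<close> matter, and the right end \<open>t + 1\<close>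
    lies beyond \<open>t\<close>, so the compact interval and the half line give the same
    derivative.\<close>
  moreover have "at t within {a..t + 1} = at t within {a..}"
    by (rule at_within_nhd[of _ "{..<t + 1}"]) auto
  ultimately show ?thesis by simp
qed

text \<open>
  The Picard operator is a contraction in the weighted norm \<open>sup |exp (- K (t - a)) u(t)|\<close> when \<open>K\<close> exceeds the
  Lipschitz constant, so the solution is obtained on the whole half line at once. The fixed point
  below is the weighted solution, extended by a constant to the left of \<open>a\<close>.
\<close>

lemma lipschitz_ivp:
  fixes h :: "real \<Rightarrow> 'a::banach \<Rightarrow> 'a"
  assumes cont: "continuous_on UNIV (\<lambda>(t, x). h t x)"
    and bound: "\<And>t. norm (h t 0) \<le> B"
    and lip: "\<And>t x y. norm (h t x - h t y) \<le> L * norm (x - y)"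
  shows "\<exists>u. u a = v \<and> (\<forall>t\<ge>a. (u has_vector_derivative h t (u t)) (at t within {a..}))"
proof -
  \<comment> \<open>The factor 2 produces the contraction constant 1/2; the maximum with 1 keeps
    \<open>K\<close> positive whatever \<open>L\<close> is.\<close>
  define K where "K = 2 * max L 1"
  have K: "K > 0" "L \<le> K / 2" by (auto simp: K_def)
  have B: "B \<ge> 0" using bound[of 0] norm_ge_zero order_trans by blast
  define I where "I = (\<lambda>(w :: real \<Rightarrow>\<^sub>C 'a) t. v + integral {a..t} (\<lambda>s. h s (exp (K * (s - a)) *\<^sub>R w s)))"
  define T where "T = (\<lambda>(w :: real \<Rightarrow>\<^sub>C 'a) t. exp (- K * (max a t - a)) *\<^sub>R I w (max a t))"
  have hc: "continuous_on S (\<lambda>s. h s (exp (K * (s - a)) *\<^sub>R w s))" for S and w :: "real \<Rightarrow>\<^sub>C 'a"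
    by (rule continuous_on_compose2[OF cont, of S "\<lambda>s. (s, exp (K * (s - a)) *\<^sub>R w s)", simplified])
      (intro continuous_intros continuous_on_apply_bcontfun)
  have hi: "(\<lambda>s. h s (exp (K * (s - a)) *\<^sub>R w s)) integrable_on {a..t}" for t and w :: "real \<Rightarrow>\<^sub>C 'a"
    by (rule integrable_continuous_real) (rule hc)
  have Ider: "(I w has_vector_derivative h t (exp (K * (t - a)) *\<^sub>R w t)) (at t within {a..})"
    if "a \<le> t" for w t
    unfolding I_def by (rule derivative_eq_intros integral_has_vector_derivative_Ici hc that | simp)+
  have Ic: "continuous_on {a..} (I w)" for w
    unfolding continuous_on_eq_continuous_within
    by (auto intro: has_vector_derivative_continuous Ider)
  have Tc: "continuous_on UNIV (T w)" for w
    unfolding T_def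
    by (intro continuous_intros continuous_on_compose2[OF Ic]) auto
  have contr: "dist (T w1 t) (T w2 t) \<le> 1/2 * dist w1 w2" for w1 w2 t
  proof -
    define r where "r = max a t - a"
    have r: "r \<ge> 0" "max a t = a + r" by (auto simp: r_def)
    define D where "D = dist w1 w2"
    \<comment> \<open>\<open>E\<close> bounds the difference of the two integrands. Its
      antiderivative is \<open>exp (K * (s - a)) * (D / 2)\<close>, so after multiplication by the
      weight \<open>exp (- K * r)\<close> at most \<open>D / 2\<close> is left.\<close>
    define E where "E = (\<lambda>s. exp (K * (s - a)) * (K / 2 * D))"
    have Ei: "(E has_integral (exp (K * r) * (D / 2) - D / 2)) {a..a + r}"
    proof -
      have "(E has_integral (exp (K * ((a + r) - a)) * (D / 2) - exp (K * (a - a)) * (D / 2))) {a..a + r}"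
        unfolding E_def using r
        by (intro fundamental_theorem_of_calculus)
          (auto intro!: derivative_eq_intros simp flip: has_real_derivative_iff_has_vector_derivative)
      then show ?thesis by simp
    qed
    have le: "norm (h s (exp (K * (s - a)) *\<^sub>R w1 s) - h s (exp (K * (s - a)) *\<^sub>R w2 s)) \<le> E s" for s
    proof -
      have "norm (h s (exp (K * (s - a)) *\<^sub>R w1 s) - h s (exp (K * (s - a)) *\<^sub>R w2 s))
          \<le> L * norm (exp (K * (s - a)) *\<^sub>R w1 s - exp (K * (s - a)) *\<^sub>R w2 s)" by (rule lip)
      also have "\<dots> = L * (exp (K * (s - a)) * dist (w1 s) (w2 s))"
        by (simp add: dist_norm flip: scaleR_diff_right)
      also have "\<dots> \<le> K / 2 * (exp (K * (s - a)) * D)"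
        using K dist_bounded[of w1 s w2] by (intro mult_mono) (auto simp: D_def)
      finally show ?thesis by (simp add: E_def mult_ac)
    qed
    have "norm (I w1 (a + r) - I w2 (a + r)) \<le> integral {a..a + r} E"
      unfolding I_def add_diff_cancel_left
      by (subst integral_diff[symmetric, OF hi hi], rule integral_norm_bound_integral)
        (use le Ei in \<open>auto intro!: integrable_diff hi\<close>)
    also have "\<dots> \<le> exp (K * r) * (D / 2)"
      using integral_unique[OF Ei] by (simp add: D_def)
    finally have *: "norm (I w1 (a + r) - I w2 (a + r)) \<le> exp (K * r) * (D / 2)" .
    have "dist (T w1 t) (T w2 t) = exp (- K * r) * norm (I w1 (a + r) - I w2 (a + r))"
      unfolding T_def r(2) by (simp add: dist_norm flip: scaleR_diff_right)
    also have "\<dots> \<le> exp (- K * r) * (exp (K * r) * (D / 2))"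
      by (intro mult_left_mono *) simp
    also have "\<dots> = 1/2 * D" by (simp flip: exp_add)
    finally show "dist (T w1 t) (T w2 t) \<le> 1/2 * dist w1 w2" by (simp add: D_def)
  qed
  \<comment> \<open>The integral grows at most like \<open>B * r\<close>, and the weight absorbs
    this, since \<open>K * r \<le> exp (K * r)\<close>. With the contraction estimate it follows
    that every \<open>T w\<close> is bounded, so the Picard operator acts on bounded continuous
    functions.\<close>
  have Tb0: "norm (T 0 t) \<le> norm v + B / K" for t
  proof -
    define r where "r = max a t - a"
    have r: "r \<ge> 0" "max a t = a + r" by (auto simp: r_def)
    have "norm (integral {a..a + r} (\<lambda>s. h s 0)) \<le> B * measure lborel {a..a + r}"
      using integrable_bound[OF B hi[of 0 "a + r", folded cbox_interval]] bound by simp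
    then have "norm (I 0 (a + r)) \<le> norm v + B * r"
      unfolding I_def using r(1) by (intro norm_triangle_mono) simp_all
    then have "norm (T 0 t) \<le> exp (- K * r) * (norm v + B * r)"
      unfolding T_def r(2) by simp
    also have "\<dots> = exp (- K * r) * norm v + B * (r * exp (- K * r))" by (simp add: algebra_simps)
    also have "\<dots> \<le> norm v + B * (1 / K)"
    proof (intro add_mono mult_left_mono B)
      show "exp (- K * r) * norm v \<le> norm v" using r K by (simp add: mult_left_le_one_le)
      have "K * r \<le> exp (K * r)" using exp_ge_add_one_self[of "K * r"] by linarith
      then show "r * exp (- K * r) \<le> 1 / K" using K by (simp add: exp_minus field_simps)
    qed
    finally show ?thesis by simp
  qed
  have Tb: "norm (T w t) \<le> (norm v + B / K) + 1/2 * dist w 0" for w t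
    using norm_triangle_sub[of "T w t" "T 0 t"] Tb0[of t] contr[of w t 0] by (simp add: dist_norm)
  define TT where "TT = (\<lambda>w. Bcontfun (T w))"
  have TT: "apply_bcontfun (TT w) = T w" for w
    unfolding TT_def by (rule Bcontfun_inverse) (rule bcontfun_normI[OF Tc Tb])
  have "dist (TT w1) (TT w2) \<le> 1/2 * dist w1 w2" for w1 w2
    by (rule dist_bound) (unfold TT, rule contr)
  then have "\<exists>!w. TT w = w"
    by (intro banach_fix_type[of "1/2"]) simp_all
  then obtain w where w: "TT w = w" by blast
  have fix_eq: "exp (K * (t - a)) *\<^sub>R w t = I w t" if "a \<le> t" for t
  proof -
    have "w t = T w t" using TT[of w] w by simp
    also have "\<dots> = exp (- K * (t - a)) *\<^sub>R I w t" using that by (simp add: T_def)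
    finally show ?thesis by (simp flip: exp_add)
  qed
  show ?thesis
  proof (intro exI[of _ "I w"] conjI allI impI)
    show "I w a = v" by (simp add: I_def)
    show "(I w has_vector_derivative h t (I w t)) (at t within {a..})" if "a \<le> t" for t
      using Ider[OF that, of w] fix_eq[OF that] by simp
  qed
qed


section \<open>Dissipative vector fields on a Hilbert space\<close>

text \<open>The squared norm is used because the norm need not be differentiable where
  \<open>w\<close> vanishes. Its derivative is at most \<open>- 2 * \<kappa>\<close> times itself
  plus \<open>2 * \<eta> * norm (w t)\<close>; Young's inequality spends half of the decay on the
  last term. What remains says that \<open>\<phi>\<close> below is nonincreasing.\<close>

lemma dissipative_estimate:
  fixes w :: "real \<Rightarrow> 'a::real_inner"
  assumes "a \<le> b" "\<kappa> > 0"
    and der: "\<And>t. t \<in> {a..b} \<Longrightarrow> (w has_vector_derivative w' t) (at t within {a..b})"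
    and diss: "\<And>t. t \<in> {a..b} \<Longrightarrow> inner (w' t) (w t) \<le> - \<kappa> * (norm (w t))\<^sup>2 + \<eta> * norm (w t)"
  shows "(norm (w b))\<^sup>2 \<le> exp (- \<kappa> * (b - a)) * (norm (w a))\<^sup>2 + (\<eta> / \<kappa>)\<^sup>2"
proof -
  define \<phi> where "\<phi> = (\<lambda>t. exp (\<kappa> * (t - a)) * ((norm (w t))\<^sup>2 - (\<eta> / \<kappa>)\<^sup>2))"
  define q where "q = (\<lambda>t. (norm (w t))\<^sup>2)"
  have \<phi>_eq: "\<phi> = (\<lambda>t. exp (\<kappa> * (t - a)) * (q t - (\<eta> / \<kappa>)\<^sup>2))"
    by (simp add: \<phi>_def q_def)
  have \<phi>: "(\<phi> has_real_derivative
      exp (\<kappa> * (t - a)) * (\<kappa> * (q t - (\<eta> / \<kappa>)\<^sup>2) + 2 * inner (w' t) (w t)))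
      (at t within {a..b})" if "t \<in> {a..b}" for t
  proof -
    have "((\<lambda>t. inner (w t) (w t)) has_derivative
        (\<lambda>s. inner (w t) (s *\<^sub>R w' t) + inner (s *\<^sub>R w' t) (w t))) (at t within {a..b})"
      using der[OF that] unfolding has_vector_derivative_def by (intro has_derivative_inner)
    moreover have "(\<lambda>s. inner (w t) (s *\<^sub>R w' t) + inner (s *\<^sub>R w' t) (w t)) = (*) (2 * inner (w' t) (w t))"
      by (auto simp: inner_commute)
    ultimately have "(q has_real_derivative 2 * inner (w' t) (w t)) (at t within {a..b})"
      by (simp add: q_def has_field_derivative_def power2_norm_eq_inner)
    then show ?thesis
      unfolding \<phi>_eq by (auto intro!: derivative_eq_intros simp: algebra_simps)
  qed
  have "\<phi> b \<le> \<phi> a"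
  proof (rule DERIV_nonpos_imp_decreasing_open[OF \<open>a \<le> b\<close>])
    show "continuous_on {a..b} \<phi>"
      unfolding continuous_on_eq_continuous_within by (auto intro: DERIV_continuous \<phi>)
    fix t assume t: "a < t" "t < b"
    \<comment> \<open>Young's inequality in the form of a completed square.\<close>
    have eq: "\<kappa> * ((norm (w t))\<^sup>2 - (\<eta> / \<kappa>)\<^sup>2) + 2 * (- \<kappa> * (norm (w t))\<^sup>2 + \<eta> * norm (w t)) =
        - \<kappa> * (norm (w t) - \<eta> / \<kappa>)\<^sup>2"
      using \<open>\<kappa> > 0\<close> by (simp add: power2_eq_square field_simps)
    have "\<kappa> * ((norm (w t))\<^sup>2 - (\<eta> / \<kappa>)\<^sup>2) + 2 * inner (w' t) (w t) \<le> - \<kappa> * (norm (w t) - \<eta> / \<kappa>)\<^sup>2"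
      using diss[of t] t unfolding eq[symmetric] by simp
    also have "\<dots> \<le> 0" using \<open>\<kappa> > 0\<close> by simp
    finally show "\<exists>y. DERIV \<phi> t :> y \<and> y \<le> 0"
      using \<phi>[of t] t by (auto simp: q_def at_within_Icc_at mult_le_0_iff)
  qed
  then have "exp (\<kappa> * (b - a)) * ((norm (w b))\<^sup>2 - (\<eta> / \<kappa>)\<^sup>2) \<le> (norm (w a))\<^sup>2 - (\<eta> / \<kappa>)\<^sup>2"
    by (simp add: \<phi>_def)
  also have "\<dots> \<le> (norm (w a))\<^sup>2" by simp
  finally have "exp (\<kappa> * (b - a)) * ((norm (w b))\<^sup>2 - (\<eta> / \<kappa>)\<^sup>2) \<le> (norm (w a))\<^sup>2" .
  then have "exp (- \<kappa> * (b - a)) * (exp (\<kappa> * (b - a)) * ((norm (w b))\<^sup>2 - (\<eta> / \<kappa>)\<^sup>2)) \<le>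
      exp (- \<kappa> * (b - a)) * (norm (w a))\<^sup>2"
    by (intro mult_left_mono) auto
  then show ?thesis by (simp add: mult.assoc[symmetric] exp_add[symmetric])
qed

section \<open>Radial retraction onto a ball\<close>

definition radial_retraction :: "real \<Rightarrow> 'a::real_normed_vector \<Rightarrow> 'a" where
  "radial_retraction R x = (R / max R (norm x)) *\<^sub>R x"

lemma norm_radial_retraction_le: "R > 0 \<Longrightarrow> norm (radial_retraction R x) \<le> R"
  by (simp add: radial_retraction_def max_def field_simps)

lemma radial_retraction_id: "R > 0 \<Longrightarrow> norm x \<le> R \<Longrightarrow> radial_retraction R x = x"
  by (simp add: radial_retraction_def max_def)

text \<open>The difference splits into a change of the vector with the scaling factor fixed and a
  change of the scaling factor. Each costs at most \<open>norm (x - y)\<close>, the second because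
  \<open>max R (norm x)\<close> is 1-Lipschitz in \<open>x\<close>; this explains the constant
  2.\<close>

lemma radial_retraction_lipschitz:
  assumes "R > 0"
  shows "norm (radial_retraction R x - radial_retraction R y) \<le> 2 * norm (x - y)"
proof -
  define p where "p = max R (norm x)"
  define q where "q = max R (norm y)"
  have pq: "p > 0" "q > 0" "R \<le> p" "norm y \<le> q" using assms by (auto simp: p_def q_def)
  have coeff: "(q - p) * (R / p) * (1 / q) = R / p - R / q"
    using pq by (simp add: field_simps)
  have "radial_retraction R x - radial_retraction R y =
      (R / p) *\<^sub>R (x - y) + ((q - p) * (R / p)) *\<^sub>R ((1 / q) *\<^sub>R y)"
    unfolding radial_retraction_def p_def[symmetric] q_def[symmetric] scaleR_scaleR coeff
    by (simp add: algebra_simps)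
  also have "norm \<dots> \<le> (R / p) * norm (x - y) + (\<bar>q - p\<bar> * (R / p)) * (norm y / q)"
    using pq assms by (intro norm_triangle_mono) (auto simp: abs_mult)
  also have "\<dots> \<le> 1 * norm (x - y) + (norm (x - y) * 1) * 1"
  proof (intro add_mono mult_mono)
    show "\<bar>q - p\<bar> \<le> norm (x - y)"
      using norm_triangle_ineq3[of x y] unfolding p_def q_def by linarith
  qed (use pq assms in auto)
  finally show ?thesis by simp
qed

section \<open>Forced equations with a dissipative right-hand side\<close>

locale dissipative_field =
  fixes G :: "'a::{real_inner,banach} \<Rightarrow> 'a" and \<kappa> :: real
  assumes rate_pos: "\<kappa> > 0"
    and lipschitz_on_balls: "\<And>R. \<exists>L. L-lipschitz_on (cball 0 R) G"
    and dissipative: "\<And>x y. inner (G x - G y) (x - y) \<le> - \<kappa> * (norm (x - y))\<^sup>2"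
    and zero: "G 0 = 0"
begin

definition solution_on :: "real set \<Rightarrow> (real \<Rightarrow> 'a) \<Rightarrow> (real \<Rightarrow> 'a) \<Rightarrow> bool" where
  "solution_on I f u \<longleftrightarrow> (\<forall>t\<in>I. (u has_vector_derivative G (u t) + f t) (at t within I))"

lemma solution_on_subset: "solution_on I f u \<Longrightarrow> J \<subseteq> I \<Longrightarrow> solution_on J f u"
  unfolding solution_on_def using has_vector_derivative_within_subset by blast

text \<open>The reference solution: comparison with it turns \<open>solution_comparison\<close> into
  the a priori bound \<open>solution_bound\<close>.\<close>

lemma solution_on_zero: "solution_on I (\<lambda>_. 0) (\<lambda>_. 0)"
  by (simp add: solution_on_def zero)

lemma solution_on_continuous: "solution_on I f u \<Longrightarrow> continuous_on I u"
  unfolding solution_on_def continuous_on_eq_continuous_within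
  using has_vector_derivative_continuous by blast

lemma solution_shift:
  assumes "solution_on UNIV f u"
  shows "solution_on UNIV (shift s f) (shift s u)"
proof -
  have "(u \<circ> (\<lambda>t. t + s) has_vector_derivative 1 *\<^sub>R (G (u (t + s)) + f (t + s))) (at t)" for t
    by (rule vector_diff_chain_at)
      (use assms in \<open>auto simp: solution_on_def intro!: derivative_eq_intros\<close>)
  then show ?thesis by (simp add: solution_on_def shift_def o_def)
qed

lemma solution_comparison:
  assumes u: "solution_on {a..b} f u" and v: "solution_on {a..b} g v" and "a \<le> b"
    and fg: "\<And>t. t \<in> {a..b} \<Longrightarrow> norm (f t - g t) \<le> \<eta>"
  shows "(norm (u b - v b))\<^sup>2 \<le> exp (- \<kappa> * (b - a)) * (norm (u a - v a))\<^sup>2 + (\<eta> / \<kappa>)\<^sup>2"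
proof (rule dissipative_estimate[OF \<open>a \<le> b\<close> rate_pos])
  fix t assume t: "t \<in> {a..b}"
  show "((\<lambda>t. u t - v t) has_vector_derivative (G (u t) + f t) - (G (v t) + g t)) (at t within {a..b})"
    using u v t unfolding solution_on_def by (intro has_vector_derivative_diff) auto
  have "inner (f t - g t) (u t - v t) \<le> \<eta> * norm (u t - v t)"
    using norm_cauchy_schwarz[of "f t - g t" "u t - v t"] mult_right_mono[OF fg[OF t]]
    by (meson norm_ge_zero order_trans)
  moreover have "inner ((G (u t) + f t) - (G (v t) + g t)) (u t - v t) =
      inner (G (u t) - G (v t)) (u t - v t) + inner (f t - g t) (u t - v t)"
    by (simp add: algebra_simps)
  ultimately show "inner ((G (u t) + f t) - (G (v t) + g t)) (u t - v t) \<le>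
      - \<kappa> * (norm (u t - v t))\<^sup>2 + \<eta> * norm (u t - v t)"
    using dissipative[of "u t" "v t"] by linarith
qed

text \<open>Equal forcings allow \<open>\<eta> = 0\<close>; the squared distance then decays at rate
  \<open>\<kappa>\<close>, and taking the root halves the rate.\<close>

lemma solution_contraction:
  assumes "solution_on {a..b} f u" "solution_on {a..b} f v" "a \<le> b"
  shows "norm (u b - v b) \<le> exp (- (\<kappa> / 2) * (b - a)) * norm (u a - v a)"
proof (rule power2_le_imp_le)
  show "(norm (u b - v b))\<^sup>2 \<le> (exp (- (\<kappa> / 2) * (b - a)) * norm (u a - v a))\<^sup>2"
    using solution_comparison[OF assms, of 0] by (simp add: power_mult_distrib flip: exp_double)
qed simp

lemma ivp_unique:
  assumes "solution_on {a..} f u" "solution_on {a..} f v" "u a = v a" "a \<le> t"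
  shows "u t = v t"
proof -
  have "solution_on {a..t} f u" "solution_on {a..t} f v"
    using solution_on_subset assms(1,2) by auto
  then show ?thesis using solution_contraction[of a t f u v] assms(3,4) by simp
qed

lemma solution_bound:
  assumes "solution_on {a..b} f u" "a \<le> b" "\<And>t. norm (f t) \<le> C"
  shows "(norm (u b))\<^sup>2 \<le> exp (- \<kappa> * (b - a)) * (norm (u a))\<^sup>2 + (C / \<kappa>)\<^sup>2"
  using solution_comparison[OF assms(1) solution_on_zero assms(2), of C] assms(3) by simp

text \<open>
  Outside a ball of radius \<open>R\<close> the field is replaced by \<open>G \<circ> r - \<kappa> (id - r)\<close>, where \<open>r\<close> is the radial
  retraction. This field is globally Lipschitz, and it still satisfies the dissipativity inequality
  against the point 0, which is enough to keep the solution in the ball.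
\<close>

lemma ivp_exists:
  assumes f: "continuous_on UNIV f" and C: "\<And>t. norm (f t) \<le> C"
  shows "\<exists>u. solution_on {a..} f u \<and> u a = v"
proof -
  have C0: "C \<ge> 0" using C[of 0] norm_ge_zero order_trans by blast
  \<comment> \<open>\<open>norm v + C / \<kappa>\<close> is the a priori bound for the solution;
    adding 1 makes the radius positive even if \<open>v\<close> and \<open>C\<close> vanish.\<close>
  define R where "R = norm v + C / \<kappa> + 1"
  have R: "R > 0" "norm v + C / \<kappa> \<le> R"
    using C0 rate_pos by (auto simp: R_def add_nonneg_pos)
  define r where "r = (radial_retraction R :: 'a \<Rightarrow> 'a)"
  obtain L where L: "L-lipschitz_on (cball 0 R) G" using lipschitz_on_balls by blast
  have L0: "L \<ge> 0" by (rule lipschitz_on_nonneg[OF L])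
  define H where "H = (\<lambda>x. G (r x) - \<kappa> *\<^sub>R (x - r x))"
  have H0: "H 0 = 0" using R by (simp add: H_def r_def radial_retraction_id zero)
  have r_le: "norm (r x) \<le> R" for x
    unfolding r_def by (rule norm_radial_retraction_le[OF R(1)])
  have r_lip: "norm (r x - r y) \<le> 2 * norm (x - y)" for x y
    unfolding r_def by (rule radial_retraction_lipschitz[OF R(1)])
  have H_lip: "norm (H x - H y) \<le> (2 * L + 3 * \<kappa>) * norm (x - y)" for x y
  proof -
    have "H x - H y = (G (r x) - G (r y)) + (- \<kappa>) *\<^sub>R ((x - y) - (r x - r y))"
      by (simp add: H_def algebra_simps)
    also have "norm \<dots> \<le> L * norm (r x - r y) + \<kappa> * (norm (x - y) + norm (r x - r y))"
    proof (intro norm_triangle_mono)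
      show "norm (G (r x) - G (r y)) \<le> L * norm (r x - r y)"
        using lipschitz_onD[OF L, of "r x" "r y"] r_le[of x] r_le[of y] by (simp add: dist_norm)
      show "norm (- \<kappa> *\<^sub>R ((x - y) - (r x - r y))) \<le> \<kappa> * (norm (x - y) + norm (r x - r y))"
        using norm_triangle_ineq4[of "x - y" "r x - r y"] rate_pos by simp
    qed
    also have "\<dots> \<le> L * (2 * norm (x - y)) + \<kappa> * (norm (x - y) + 2 * norm (x - y))"
      using r_lip[of x y] L0 rate_pos by (intro add_mono mult_left_mono) auto
    finally show ?thesis by (simp add: algebra_simps)
  qed
  have H_diss: "inner (H x) x \<le> - \<kappa> * (norm x)\<^sup>2" for x
  proof -
    \<comment> \<open>Dissipativity between \<open>r x = c *\<^sub>R x\<close> and 0, divided by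
      \<open>c > 0\<close>, yields only the fraction \<open>c\<close> of the desired decay; the
      correction term in \<open>H\<close> supplies the missing fraction
      \<open>1 - c\<close>.\<close>
    define c where "c = R / max R (norm x)"
    have c: "c > 0" unfolding c_def by (rule divide_pos_pos) (use R in linarith)+
    have rx: "r x = c *\<^sub>R x" by (simp add: r_def radial_retraction_def c_def)
    have "c * inner (G (r x)) x \<le> c * (- \<kappa> * c * (norm x)\<^sup>2)"
      using dissipative[of "r x" 0] by (simp add: rx zero power_mult_distrib power2_eq_square mult_ac)
    then have "inner (G (r x)) x \<le> - \<kappa> * c * (norm x)\<^sup>2"
      using c by (simp only: mult_le_cancel_left_pos)
    moreover have "inner (H x) x = inner (G (r x)) x - \<kappa> * (1 - c) * (norm x)\<^sup>2"
      unfolding H_def rx by (simp add: power2_norm_eq_inner algebra_simps)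
    ultimately show ?thesis by (simp add: algebra_simps)
  qed
  have Hc: "continuous_on UNIV H"
    by (rule lipschitz_on_continuous_on[of "2 * L + 3 * \<kappa>"], rule lipschitz_onI)
      (use H_lip L0 rate_pos in \<open>auto simp: dist_norm\<close>)
  have hc: "continuous_on UNIV (\<lambda>(t, x). H x + f t)"
    unfolding case_prod_unfold
    by (intro continuous_intros continuous_on_compose2[OF f] continuous_on_compose2[OF Hc]) auto
  obtain u where u: "u a = v"
    "\<And>t. a \<le> t \<Longrightarrow> (u has_vector_derivative H (u t) + f t) (at t within {a..})"
    using lipschitz_ivp[OF hc, of C "2 * L + 3 * \<kappa>" a v] C H_lip H0 by auto
  have "norm (u t) \<le> R" if "a \<le> t" for t
  proof (rule power2_le_imp_le)
    have "(norm (u t))\<^sup>2 \<le> exp (- \<kappa> * (t - a)) * (norm (u a))\<^sup>2 + (C / \<kappa>)\<^sup>2"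
    proof (rule dissipative_estimate[OF that rate_pos])
      fix s assume s: "s \<in> {a..t}"
      then show "(u has_vector_derivative H (u s) + f s) (at s within {a..t})"
        using has_vector_derivative_within_subset[OF u(2), of s "{a..t}"] by auto
      have "inner (f s) (u s) \<le> C * norm (u s)"
        using norm_cauchy_schwarz[of "f s" "u s"] mult_right_mono[OF C]
        by (meson norm_ge_zero order_trans)
      then show "inner (H (u s) + f s) (u s) \<le> - \<kappa> * (norm (u s))\<^sup>2 + C * norm (u s)"
        using H_diss[of "u s"] by (simp add: inner_add_left)
    qed
    also have "\<dots> \<le> (norm v)\<^sup>2 + (C / \<kappa>)\<^sup>2"
      using that rate_pos u(1) by (simp add: mult_left_le_one_le)
    also have "\<dots> \<le> (norm v + C / \<kappa>)\<^sup>2"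
      using C0 rate_pos by (simp add: power2_sum)
    also have "\<dots> \<le> R\<^sup>2"
      using R C0 rate_pos by (intro power_mono) auto
    finally show "(norm (u t))\<^sup>2 \<le> R\<^sup>2" .
  qed (use R in simp)
  then have "H (u t) = G (u t)" if "a \<le> t" for t
    using that R by (simp add: H_def r_def radial_retraction_id)
  then show ?thesis using u by (auto simp: solution_on_def)
qed

text \<open>The solutions \<open>U n\<close> started from 0 at time \<open>- n\<close> never leave
  the ball of radius \<open>C / \<kappa>\<close>, and contraction makes them Cauchy at each time.
  Since \<open>G\<close> is Lipschitz on that ball, their derivatives converge locally uniformly, so
  the pointwise limit is again a solution.\<close>

lemma bounded_solution_exists:
  assumes f: "continuous_on UNIV f" and C: "\<And>t. norm (f t) \<le> C"
  shows "\<exists>u. solution_on UNIV f u \<and> (\<forall>t. norm (u t) \<le> C / \<kappa>)"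
proof -
  have "C \<ge> 0" using C[of 0] norm_ge_zero order_trans by blast
  then have C0: "C / \<kappa> \<ge> 0" using rate_pos by simp
  have "\<forall>n::nat. \<exists>u. solution_on {- real n..} f u \<and> u (- real n) = 0"
    using ivp_exists[OF f C] by blast
  then obtain U where U: "\<And>n. solution_on {- real n..} f (U n)" "\<And>n. U n (- real n) = 0"
    by metis
  have bound: "norm (U n t) \<le> C / \<kappa>" if "- real n \<le> t" for n t
  proof (rule power2_le_imp_le[OF _ C0])
    have "solution_on {- real n..t} f (U n)" by (rule solution_on_subset[OF U(1)]) auto
    then show "(norm (U n t))\<^sup>2 \<le> (C / \<kappa>)\<^sup>2"
      using solution_bound[of "- real n" t f "U n" C] that C U(2)[of n] by simp
  qed
  \<comment> \<open>For \<open>m \<ge> n\<close> the solutions \<open>U m\<close> and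
    \<open>U n\<close> are at most \<open>C / \<kappa>\<close> apart at time \<open>- n\<close>;
    \<open>E t n\<close> is what contraction leaves of this at time \<open>t\<close>.\<close>
  define E where "E = (\<lambda>t n. exp (- (\<kappa> / 2) * (t + real n)) * (C / \<kappa>))"
  have E0: "E t \<longlonglongrightarrow> 0" for t
  proof -
    have "(\<lambda>n. exp (- (\<kappa> / 2)) ^ n) \<longlonglongrightarrow> 0"
      using rate_pos by (intro LIMSEQ_power_zero) simp
    then have "(\<lambda>n. exp (- (\<kappa> / 2) * t) * exp (- (\<kappa> / 2)) ^ n * (C / \<kappa>)) \<longlonglongrightarrow> 0"
      by (intro tendsto_mult_left_zero tendsto_mult_right_zero)
    moreover have "exp (- (\<kappa> / 2) * (t + real n)) = exp (- (\<kappa> / 2) * t) * exp (- (\<kappa> / 2)) ^ n" for n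
    proof -
      have "- (\<kappa> / 2) * (t + real n) = - (\<kappa> / 2) * t + real n * - (\<kappa> / 2)"
        by (simp add: algebra_simps)
      then show ?thesis by (simp only: exp_add exp_of_nat_mult)
    qed
    ultimately show ?thesis by (simp add: E_def)
  qed
  have close: "norm (U m t - U n t) \<le> E t n" if "n \<le> m" "- real n \<le> t" for m n t
  proof -
    have "solution_on {- real n..t} f (U m)" "solution_on {- real n..t} f (U n)"
      by (rule solution_on_subset[OF U(1)]; use that in auto)+
    then have "norm (U m t - U n t) \<le> exp (- (\<kappa> / 2) * (t - - real n)) * norm (U m (- real n) - U n (- real n))"
      by (rule solution_contraction) (use that in simp)
    also have "\<dots> \<le> exp (- (\<kappa> / 2) * (t - - real n)) * (C / \<kappa>)"
      using bound[of m "- real n"] U(2)[of n] that by (intro mult_left_mono) auto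
    finally show ?thesis by (simp add: E_def)
  qed
  have "\<exists>l. (\<lambda>n. U n t) \<longlonglongrightarrow> l" for t
  proof -
    have "Cauchy (\<lambda>n. U n t)"
      unfolding Cauchy_iff
    proof (intro allI impI)
      fix e :: real assume "e > 0"
      have "\<forall>\<^sub>F n in sequentially. E t n < e / 2"
        by (rule order_tendstoD(2)[OF E0]) (use \<open>e > 0\<close> in simp)
      moreover have "\<forall>\<^sub>F n in sequentially. n \<ge> nat \<lceil>- t\<rceil>" by (rule eventually_ge_at_top)
      ultimately have "\<exists>N. E t N < e / 2 \<and> N \<ge> nat \<lceil>- t\<rceil>"
        by (intro eventually_happens'[OF sequentially_bot] eventually_conj)
      then obtain N where N: "E t N < e / 2" "N \<ge> nat \<lceil>- t\<rceil>" by blast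
      then have "- real N \<le> t" by linarith
      then have near: "norm (U n t - U N t) < e / 2" if "n \<ge> N" for n
        using close[OF that, of t] N(1) by simp
      have "norm (U m t - U n t) < e" if "m \<ge> N" "n \<ge> N" for m n
        using norm_triangle_ineq4[of "U m t - U N t" "U n t - U N t"] near[OF that(1)] near[OF that(2)]
        by simp
      then show "\<exists>M. \<forall>m\<ge>M. \<forall>n\<ge>M. norm (U m t - U n t) < e" by blast
    qed
    then show ?thesis using Cauchy_convergent unfolding convergent_def by blast
  qed
  then obtain u where u: "\<And>t. (\<lambda>n. U n t) \<longlonglongrightarrow> u t" by metis
  have ev: "\<forall>\<^sub>F n in sequentially. - real n \<le> t" for t
    using eventually_ge_at_top[of "nat \<lceil>- t\<rceil>"] by eventually_elim linarith
  have u_bound: "norm (u t) \<le> C / \<kappa>" for t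
    by (rule Lim_norm_ubound[OF sequentially_bot u eventually_mono[OF ev bound]])
  have u_close: "norm (u t - U n t) \<le> E t n" if "- real n \<le> t" for t n
    by (rule Lim_norm_ubound[OF sequentially_bot tendsto_diff[OF u tendsto_const]],
        rule eventually_sequentiallyI[of n], rule close[OF _ that])
  obtain L where L: "L-lipschitz_on (cball 0 (C / \<kappa>)) G" using lipschitz_on_balls by blast
  have L0: "L \<ge> 0" by (rule lipschitz_on_nonneg[OF L])
  have "(u has_vector_derivative G (u t) + f t) (at t)" for t
  proof -
    \<comment> \<open>Dropping the first \<open>N\<close> terms leaves solutions that have all
      started before the unit ball \<open>S\<close> around \<open>t\<close>.\<close>
    obtain N :: nat where "1 - t \<le> real N" using real_arch_simple by blast
    then have N: "- real N \<le> t - 1" by linarith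
    define S where "S = ball t 1"
    have S: "- real (n + N) \<le> x" "t - 1 \<le> x" if "x \<in> S" for x n
      using that N by (auto simp: S_def dist_real_def)
    have "\<exists>g. \<forall>x\<in>S. (\<lambda>n. U (n + N) x) \<longlonglongrightarrow> g x \<and>
        (g has_derivative (\<lambda>h. h *\<^sub>R (G (u x) + f x))) (at x within S)"
    proof (rule has_derivative_sequence)
      show "convex S" "t \<in> S" by (auto simp: S_def)
      show "(\<lambda>n. U (n + N) t) \<longlonglongrightarrow> u t" using u by (rule LIMSEQ_ignore_initial_segment)
      show "(U (n + N) has_derivative (\<lambda>h. h *\<^sub>R (G (U (n + N) x) + f x))) (at x within S)"
        if "x \<in> S" for n x
      proof -
        have "solution_on S f (U (n + N))"
          by (rule solution_on_subset[OF U(1)[of "n + N"]]) (use S in auto)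
        then show ?thesis using that by (simp add: solution_on_def has_vector_derivative_def)
      qed
      fix e :: real assume e: "e > 0"
      \<comment> \<open>\<open>E\<close> does not increase with time, so its value at the left end
        \<open>t - 1\<close> of \<open>S\<close> controls the error uniformly on
        \<open>S\<close>.\<close>
      have "(\<lambda>n. L * E (t - 1) (n + N)) \<longlonglongrightarrow> 0"
        by (rule tendsto_mult_right_zero[OF LIMSEQ_ignore_initial_segment[OF E0]])
      from order_tendstoD(2)[OF this e]
      show "\<forall>\<^sub>F n in sequentially. \<forall>x\<in>S. \<forall>h.
          norm (h *\<^sub>R (G (U (n + N) x) + f x) - h *\<^sub>R (G (u x) + f x)) \<le> e * norm h"
      proof eventually_elim
        case (elim n)
        show ?case
        proof (intro ballI allI)
          fix x h assume x: "x \<in> S"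
          have "norm (G (U (n + N) x) - G (u x)) \<le> L * norm (U (n + N) x - u x)"
            using lipschitz_onD[OF L, of "U (n + N) x" "u x"] bound[OF S(1)[OF x]] u_bound
            by (simp add: dist_norm)
          also have "\<dots> \<le> L * E (t - 1) (n + N)"
          proof (rule mult_left_mono[OF _ L0])
            have "norm (U (n + N) x - u x) \<le> E x (n + N)"
              using u_close[OF S(1)[OF x]] by (simp add: norm_minus_commute)
            also have "\<dots> \<le> E (t - 1) (n + N)"
              using S(2)[OF x] C0 rate_pos unfolding E_def by (intro mult_right_mono) auto
            finally show "norm (U (n + N) x - u x) \<le> E (t - 1) (n + N)" .
          qed
          finally have "norm (G (U (n + N) x) - G (u x)) \<le> e" using elim by simp
          then have "\<bar>h\<bar> * norm (G (U (n + N) x) - G (u x)) \<le> \<bar>h\<bar> * e"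
            by (rule mult_left_mono) simp
          moreover have "h *\<^sub>R (G (U (n + N) x) + f x) - h *\<^sub>R (G (u x) + f x) =
              h *\<^sub>R (G (U (n + N) x) - G (u x))"
            by (simp add: algebra_simps)
          ultimately show "norm (h *\<^sub>R (G (U (n + N) x) + f x) - h *\<^sub>R (G (u x) + f x)) \<le> e * norm h"
            by (simp add: mult.commute)
        qed
      qed
    qed
    then obtain g where g: "\<And>x. x \<in> S \<Longrightarrow> (\<lambda>n. U (n + N) x) \<longlonglongrightarrow> g x"
      "\<And>x. x \<in> S \<Longrightarrow> (g has_derivative (\<lambda>h. h *\<^sub>R (G (u x) + f x))) (at x within S)"
      by blast
    have gu: "g x = u x" if "x \<in> S" for x
      using LIMSEQ_unique[OF g(1)[OF that] LIMSEQ_ignore_initial_segment[OF u]] .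
    have t: "t \<in> S" "open S" by (auto simp: S_def)
    then have "(g has_vector_derivative G (u t) + f t) (at t)"
      using g(2)[OF t(1)] by (simp only: has_vector_derivative_def at_within_open)
    then show ?thesis
      by (rule has_vector_derivative_transform_within_open[of _ _ _ S]) (use t gu in auto)
  qed
  then show ?thesis using u_bound by (auto simp: solution_on_def)
qed

text \<open>At time \<open>t - n\<close> the two solutions are at most \<open>2 * B\<close> apart;
  contraction from there to \<open>t\<close> and \<open>n\<close> tending to infinity force
  equality.\<close>

lemma bounded_solution_unique:
  assumes "solution_on UNIV f u" "solution_on UNIV f v"
    and "\<And>t. norm (u t) \<le> B" "\<And>t. norm (v t) \<le> B"
  shows "u = v"
proof
  fix t
  have B: "norm (u s - v s) \<le> 2 * B" for s
    using norm_triangle_ineq4[of "u s" "v s"] assms(3,4)[of s] by linarith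
  have "norm (u t - v t) \<le> exp (- (\<kappa> / 2)) ^ n * (2 * B)" for n
  proof -
    have "solution_on {t - real n..t} f u" "solution_on {t - real n..t} f v"
      using solution_on_subset assms by blast+
    then have "norm (u t - v t) \<le>
        exp (- (\<kappa> / 2) * (t - (t - real n))) * norm (u (t - real n) - v (t - real n))"
      by (rule solution_contraction) simp
    also have "\<dots> \<le> exp (- (\<kappa> / 2) * (t - (t - real n))) * (2 * B)"
      by (rule mult_left_mono[OF B]) simp
    finally show ?thesis by (simp add: mult.commute flip: exp_of_nat_mult)
  qed
  moreover have "(\<lambda>n. exp (- (\<kappa> / 2)) ^ n * (2 * B)) \<longlonglongrightarrow> 0"
    using rate_pos by (intro tendsto_mult_left_zero LIMSEQ_power_zero) simp
  ultimately have "norm (u t - v t) \<le> 0"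
    by (intro LIMSEQ_le_const) auto
  then show "u t = v t" by simp
qed

text \<open>
  The value of a bounded solution at a time \<open>r\<close> depends, up to an exponentially small error, only on
  the forcing over a window \<open>[r - T, r]\<close>; this makes the map \<open>f \<mapsto> u\<close> uniformly continuous for the
  compact-open metrics along the orbit of \<open>f\<close>.
\<close>

lemma bounded_solution_comparable:
  assumes u: "solution_on UNIV f u" and f: "continuous_on UNIV f"
    and B: "\<And>t. norm (u t) \<le> B" and \<epsilon>: "\<epsilon> > 0"
  shows "\<exists>\<delta>>0. \<forall>s t. compact_open_dist (shift s f) (shift t f) < \<delta> \<longrightarrow>
    compact_open_dist (shift s u) (shift t u) < \<epsilon>"
proof -
  have cs: "continuous_on UNIV (shift s g)" if "continuous_on UNIV g" for s and g :: "real \<Rightarrow> 'a"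
    unfolding shift_def by (intro continuous_on_compose2[OF that] continuous_intros) auto
  have uc: "continuous_on UNIV u" by (rule solution_on_continuous[OF u])
  \<comment> \<open>The window length \<open>T\<close> is chosen so that an initial gap of at most
    \<open>2 * B\<close> has decayed, in squared norm, below
    \<open>\<epsilon>\<^sup>2 / 8\<close>.\<close>
  have "(\<lambda>n. exp (- \<kappa>) ^ n * (2 * B)\<^sup>2) \<longlonglongrightarrow> 0"
    using rate_pos by (intro tendsto_mult_left_zero LIMSEQ_power_zero) simp
  then have "\<forall>\<^sub>F n in sequentially. exp (- \<kappa>) ^ n * (2 * B)\<^sup>2 < \<epsilon>\<^sup>2 / 8"
    using \<epsilon> by (intro order_tendstoD) auto
  then obtain n where n: "exp (- \<kappa>) ^ n * (2 * B)\<^sup>2 < \<epsilon>\<^sup>2 / 8"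
    by (meson eventually_happens trivial_limit_sequentially)
  define T where "T = real n"
  have T: "T \<ge> 0" "exp (- \<kappa> * T) * (2 * B)\<^sup>2 < \<epsilon>\<^sup>2 / 8"
    using n by (auto simp: T_def mult.commute simp flip: exp_of_nat_mult)
  \<comment> \<open>With this \<open>\<eta>\<close> the forcing contributes
    \<open>(\<epsilon> / 4)\<^sup>2\<close>, and together with \<open>\<epsilon>\<^sup>2 / 8\<close>
    it stays below \<open>(\<epsilon> / 2)\<^sup>2\<close>. The bound on \<open>\<delta>\<close>
    makes \<open>1 / \<delta> \<ge> 2 / \<epsilon> + T\<close>, so that the forcings are close on
    every window \<open>{r - T..r}\<close> with
    \<open>\<bar>r\<bar> \<le> 2 / \<epsilon>\<close>.\<close>
  define \<eta> where "\<eta> = \<kappa> * \<epsilon> / 4"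
  define \<delta> where "\<delta> = min \<eta> (1 / (2 / \<epsilon> + T))"
  have pos: "2 / \<epsilon> + T > 0" using \<epsilon> T by (simp add: add_pos_nonneg)
  have \<delta>: "\<delta> > 0" "\<delta> \<le> \<eta>" using \<epsilon> rate_pos pos by (auto simp: \<delta>_def \<eta>_def)
  have "\<delta> \<le> 1 / (2 / \<epsilon> + T)" by (simp add: \<delta>_def)
  then have \<delta>': "2 / \<epsilon> + T \<le> 1 / \<delta>" using \<delta> pos by (simp add: field_simps)
  have "compact_open_dist (shift s u) (shift t u) < \<epsilon>"
    if st: "compact_open_dist (shift s f) (shift t f) < \<delta>" for s t
  proof -
    have "compact_open_dist (shift s u) (shift t u) \<le> \<epsilon> / 2"
    proof (rule compact_open_dist_leI[OF cs[OF uc] cs[OF uc]])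
      fix r assume "\<bar>r\<bar> \<le> 1 / (\<epsilon> / 2)"
      then have r: "\<bar>r\<bar> \<le> 2 / \<epsilon>" by simp
      have "solution_on {r - T..r} (shift s f) (shift s u)"
        "solution_on {r - T..r} (shift t f) (shift t u)"
        using solution_on_subset[OF solution_shift[OF u]] by auto
      then have "(norm (shift s u r - shift t u r))\<^sup>2 \<le>
          exp (- \<kappa> * (r - (r - T))) * (norm (shift s u (r - T) - shift t u (r - T)))\<^sup>2 + (\<eta> / \<kappa>)\<^sup>2"
      proof (rule solution_comparison)
        fix p assume "p \<in> {r - T..r}"
        then have "\<bar>p\<bar> \<le> 1 / \<delta>" using r T \<delta>' by auto
        then have "norm (shift s f p - shift t f p) < \<delta>"
          by (rule compact_open_dist_lessD[OF cs[OF f] cs[OF f] st \<delta>(1)])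
        then show "norm (shift s f p - shift t f p) \<le> \<eta>" using \<delta> by simp
      qed (use T in simp)
      also have "\<dots> \<le> exp (- \<kappa> * T) * (2 * B)\<^sup>2 + (\<epsilon> / 4)\<^sup>2"
      proof (intro add_mono mult_mono power_mono)
        show "norm (shift s u (r - T) - shift t u (r - T)) \<le> 2 * B"
          using norm_triangle_ineq4[of "u (r - T + s)" "u (r - T + t)"] B[of "r - T + s"] B[of "r - T + t"]
          by (simp add: shift_def)
      qed (use rate_pos \<epsilon> in \<open>auto simp: \<eta>_def\<close>)
      also have "\<dots> \<le> \<epsilon>\<^sup>2 / 8 + (\<epsilon> / 4)\<^sup>2" using T by simp
      also have "\<dots> \<le> (\<epsilon> / 2)\<^sup>2" by (simp add: power2_eq_square)
      finally show "norm (shift s u r - shift t u r) \<le> \<epsilon> / 2"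
        by (rule power2_le_imp_le) (use \<epsilon> in simp)
    qed (use \<epsilon> in simp)
    then show ?thesis using \<epsilon> by simp
  qed
  then show ?thesis using \<delta> by blast
qed

end


section \<open>Comparability of motions\<close>

context dynamical_system
begin

text \<open>Equivalently, sending \<open>\<pi> t x\<close> to \<open>\<pi> t y\<close> is a
  well-defined, uniformly continuous map of orbits. Two free times are used because total
  boundedness compares arbitrary orbit points; return times need only \<open>t = 0\<close>.\<close>

definition uniformly_comparable :: "'a \<Rightarrow> 'a \<Rightarrow> bool" where
  "uniformly_comparable x y \<longleftrightarrow> x \<in> M \<and> y \<in> M \<and>
    (\<forall>\<epsilon>>0. \<exists>\<delta>>0. \<forall>s t. d (\<pi> s x) (\<pi> t x) < \<delta> \<longrightarrow> d (\<pi> s y) (\<pi> t y) < \<epsilon>)"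

text \<open>Completeness of the space trades compactness of the orbit closure for finite nets of the
  orbit, which transfer along comparable motions.\<close>

lemma lagrange_stable_iff_mtotally_bounded:
  "lagrange_stable x \<longleftrightarrow> x \<in> M \<and> mtotally_bounded (trajectory x)"
  unfolding lagrange_stable_def mtotally_bounded_eq_compact_closure_of[OF complete]
  by (auto simp: trajectory_def flow_in)

context
  fixes x y
  assumes xy: "uniformly_comparable x y"
begin

lemma comparable_in_carrier: "x \<in> M" "y \<in> M"
  using xy by (simp_all add: uniformly_comparable_def)

lemma comparableE:
  assumes "\<epsilon> > 0"
  obtains \<delta> where "\<delta> > 0"
    "\<And>s t. d (\<pi> s x) (\<pi> t x) < \<delta> \<Longrightarrow> d (\<pi> s y) (\<pi> t y) < \<epsilon>"
  using xy assms unfolding uniformly_comparable_def by blast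

lemma comparable_returnE:
  assumes "\<epsilon> > 0"
  obtains \<delta> where "\<delta> > 0" "\<And>t. d (\<pi> t x) x < \<delta> \<Longrightarrow> d (\<pi> t y) y < \<epsilon>"
proof -
  obtain \<delta> where \<delta>: "\<delta> > 0"
    "\<And>s t. d (\<pi> s x) (\<pi> t x) < \<delta> \<Longrightarrow> d (\<pi> s y) (\<pi> t y) < \<epsilon>"
    using comparableE[OF assms] by blast
  have "\<pi> 0 x = x" "\<pi> 0 y = y" by (simp_all add: flow_zero comparable_in_carrier)
  then show ?thesis using that[OF \<delta>(1)] \<delta>(2)[of _ 0] by simp
qed

text \<open>A finite net of the orbit of \<open>x\<close> with centres on the orbit is given by
  finitely many times; the same times give a net of the orbit of \<open>y\<close>.\<close>

lemma comparable_lagrange_stable: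
  assumes "lagrange_stable x"
  shows "lagrange_stable y"
proof -
  have "mtotally_bounded (trajectory y)"
    unfolding mtotally_bounded_def
  proof (intro allI impI)
    fix \<epsilon> :: real assume "\<epsilon> > 0"
    then obtain \<delta> where \<delta>: "\<delta> > 0"
      "\<And>s t. d (\<pi> s x) (\<pi> t x) < \<delta> \<Longrightarrow> d (\<pi> s y) (\<pi> t y) < \<epsilon>"
      using comparableE by blast
    obtain K where K: "finite K" "K \<subseteq> trajectory x" "trajectory x \<subseteq> (\<Union>p\<in>K. mball p \<delta>)"
      using assms \<delta> unfolding lagrange_stable_iff_mtotally_bounded mtotally_bounded_def by blast
    obtain T where T: "finite T" "K = (\<lambda>t. \<pi> t x) ` T"
      using finite_subset_image[OF K(1,2)[unfolded trajectory_def]] by blast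
    have "trajectory y \<subseteq> (\<Union>p\<in>(\<lambda>t. \<pi> t y) ` T. mball p \<epsilon>)"
      unfolding trajectory_def
    proof (rule image_subsetI)
      fix t
      have "\<pi> t x \<in> (\<Union>p\<in>K. mball p \<delta>)" using K(3) unfolding trajectory_def by blast
      then obtain s where "s \<in> T" "d (\<pi> s x) (\<pi> t x) < \<delta>" using T(2) by auto
      then show "\<pi> t y \<in> (\<Union>p\<in>(\<lambda>t. \<pi> t y) ` T. mball p \<epsilon>)"
        using \<delta>(2) comparable_in_carrier flow_in by auto
    qed
    then show "\<exists>K. finite K \<and> K \<subseteq> trajectory y \<and> trajectory y \<subseteq> (\<Union>p\<in>K. mball p \<epsilon>)"
      using T(1) by (intro exI[of _ "(\<lambda>t. \<pi> t y) ` T"]) (auto simp: trajectory_def)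
  qed
  then show ?thesis
    unfolding lagrange_stable_iff_mtotally_bounded using comparable_in_carrier by blast
qed

lemma comparable_almost_recurrent:
  assumes "almost_recurrent x"
  shows "almost_recurrent y"
  unfolding almost_recurrent_def
proof (intro conjI allI impI)
  fix \<epsilon> :: real assume "\<epsilon> > 0"
  then obtain \<delta> where \<delta>: "\<delta> > 0" "\<And>t. d (\<pi> t x) x < \<delta> \<Longrightarrow> d (\<pi> t y) y < \<epsilon>"
    using comparable_returnE by blast
  have "relatively_dense {\<tau>. d (\<pi> \<tau> x) x < \<delta>}"
    using assms \<delta> by (simp add: almost_recurrent_def)
  then show "relatively_dense {\<tau>. d (\<pi> \<tau> y) y < \<epsilon>}"
    unfolding relatively_dense_def using \<delta>(2) by blast
qed (rule comparable_in_carrier)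

lemma comparable_return_sequences: "return_sequences x \<subseteq> return_sequences y"
proof
  fix t assume "t \<in> return_sequences x"
  then have t: "\<And>\<delta>. \<delta> > 0 \<Longrightarrow> \<exists>N. \<forall>n\<ge>N. d (\<pi> (t n) x) x < \<delta>"
    unfolding return_sequences_def limit_metric_sequentially by blast
  have "\<exists>N. \<forall>n\<ge>N. d (\<pi> (t n) y) y < \<epsilon>" if \<epsilon>: "\<epsilon> > 0" for \<epsilon>
  proof -
    obtain \<delta> where \<delta>: "\<delta> > 0" "\<And>t. d (\<pi> t x) x < \<delta> \<Longrightarrow> d (\<pi> t y) y < \<epsilon>"
      using comparable_returnE[OF \<epsilon>] by blast
    then show ?thesis using t[OF \<delta>(1)] by blast
  qed
  then show "t \<in> return_sequences y"
    unfolding return_sequences_def limit_metric_sequentially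
    using comparable_in_carrier flow_in by auto
qed

lemma comparable_recurrent: "recurrent x \<Longrightarrow> recurrent y"
  using comparable_almost_recurrent comparable_lagrange_stable by (auto simp: recurrent_def)

text \<open>The auxiliary system and almost periodic point chosen for \<open>x\<close> also serve
  for \<open>y\<close>, since return sequences of \<open>x\<close> return \<open>y\<close>.\<close>

lemma comparable_almost_automorphic: "almost_automorphic x \<Longrightarrow> almost_automorphic y"
  unfolding almost_automorphic_def levitan_almost_periodic_def
  using comparable_lagrange_stable comparable_return_sequences comparable_in_carrier
  by (meson order_trans)

end

end

section \<open>Lagrange stable functions\<close>

lemma lagrange_stable_function_continuous:
  "shift_system.lagrange_stable f \<Longrightarrow> continuous_on UNIV f"
  unfolding shift_system.lagrange_stable_def unfolding continuous_functions_def by simp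

text \<open>The value \<open>f t\<close> is the value at 0 of \<open>shift t f\<close>, which lies
  within distance 1 of one of finitely many functions; the sum over \<open>K\<close> dominates their
  values at 0.\<close>

lemma lagrange_stable_function_bounded:
  fixes f :: "real \<Rightarrow> 'a::banach"
  assumes "shift_system.lagrange_stable f"
  obtains C where "\<And>t. norm (f t) \<le> C"
proof -
  have f: "f \<in> continuous_functions" using assms by (simp add: shift_system.lagrange_stable_def)
  obtain K where K: "finite K" "shift_system.trajectory f \<subseteq> (\<Union>g\<in>K. compact_open.mball g 1)"
    using assms unfolding shift_system.lagrange_stable_iff_mtotally_bounded
      compact_open.mtotally_bounded_def by (meson zero_less_one)
  have "norm (f t) \<le> 1 + (\<Sum>g\<in>K. norm (g 0))" for t
  proof -
    have "shift t f \<in> (\<Union>g\<in>K. compact_open.mball g 1)"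
      using K(2) unfolding shift_system.trajectory_def by blast
    then obtain g where g: "g \<in> K" "g \<in> continuous_functions" "shift t f \<in> continuous_functions"
      "compact_open_dist g (shift t f) < 1"
      by auto
    have "norm (g 0 - shift t f 0) < 1"
      by (rule compact_open_dist_lessD) (use g in \<open>auto simp: continuous_functions_def\<close>)
    moreover have "norm (g 0) \<le> (\<Sum>g\<in>K. norm (g 0))"
      using K(1) g(1) by (intro member_le_sum) auto
    ultimately show ?thesis
      using norm_triangle_sub[of "f t" "g 0"] by (simp add: shift_def norm_minus_commute)
  qed
  then show ?thesis using that by blast
qed


section \<open>The lattice vector field\<close>

text \<open>The free translation \<open>k\<close> lets both Laplacian estimates be proved termwise,
  with neighbouring coordinates contributing the same total.\<close>

lemma norm_ell2_has_sum: "((\<lambda>i. (coord x (i + k))\<^sup>2) has_sum (norm x)\<^sup>2) UNIV"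
proof -
  have "((\<lambda>i. (coord x i)\<^sup>2) has_sum (norm x)\<^sup>2) UNIV"
    using coord[of x] by (simp add: norm_ell2_square)
  then show ?thesis
    using has_sum_reindex_bij_betw[of "\<lambda>i. i + k" UNIV UNIV "\<lambda>i. (coord x i)\<^sup>2"]
    by (simp add: bij_plus_right)
qed

lemma norm_ell2_le_coordwise:
  assumes "\<And>i. (coord x i)\<^sup>2 \<le> c * (coord y i)\<^sup>2"
  shows "(norm x)\<^sup>2 \<le> c * (norm y)\<^sup>2"
  using has_sum_mono[OF norm_ell2_has_sum[of x 0] has_sum_cmult_right[OF norm_ell2_has_sum[of y 0]]]
    assms by simp

lemma inner_ell2_has_sum: "((\<lambda>i. coord x i * coord y i) has_sum inner x y) UNIV"
  using square_summable_mult coord[of x] coord[of y] by (simp add: inner_ell2.rep_eq)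

lemma laplacian_diff: "laplacian (u - v) = laplacian u - laplacian v"
  by transfer (simp add: fun_eq_iff)

lemma inner_laplacian_nonpos: "inner (laplacian u) u \<le> 0"
proof -
  define S where "S = (norm u)\<^sup>2"
  let ?f = "\<lambda>i. coord (laplacian u) i * coord u i"
  \<comment> \<open>\<open>?g\<close> has sum 0 and exceeds \<open>?f\<close> by half the squared
    differences to the two neighbours: summation by parts in termwise form.\<close>
  let ?g = "\<lambda>i. 1/2 * (coord u (i + (- 1)))\<^sup>2 + - 1 * (coord u (i + 0))\<^sup>2 + 1/2 * (coord u (i + 1))\<^sup>2"
  have g: "(?g has_sum (1/2 * S + - 1 * S + 1/2 * S)) UNIV"
    unfolding S_def by (intro has_sum_add has_sum_cmult_right norm_ell2_has_sum)
  have "?f i \<le> ?g i" for i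
  proof -
    have "?g i - ?f i = 1/2 * (coord u (i - 1) - coord u i)\<^sup>2 + 1/2 * (coord u (i + 1) - coord u i)\<^sup>2"
      by (simp add: laplacian.rep_eq power2_eq_square algebra_simps)
    also have "\<dots> \<ge> 0" by simp
    finally show ?thesis by simp
  qed
  then have "inner (laplacian u) u \<le> 1/2 * S + - 1 * S + 1/2 * S"
    by (intro has_sum_mono[OF inner_ell2_has_sum g]) auto
  then show ?thesis by simp
qed

lemma norm_laplacian_le: "norm (laplacian u) \<le> 4 * norm u"
proof (rule power2_le_imp_le)
  define S where "S = (norm u)\<^sup>2"
  \<comment> \<open>Cauchy-Schwarz with weights 1, 2, 1, of total 4, bounds the squared term by
    \<open>?g\<close>; the coefficients add up to 16, the square of the constant 4.\<close>
  let ?g = "\<lambda>i. 4 * (coord u (i + (- 1)))\<^sup>2 + 8 * (coord u (i + 0))\<^sup>2 + 4 * (coord u (i + 1))\<^sup>2"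
  have g: "(?g has_sum (4 * S + 8 * S + 4 * S)) UNIV"
    unfolding S_def by (intro has_sum_add has_sum_cmult_right norm_ell2_has_sum)
  have "(coord (laplacian u) (i + 0))\<^sup>2 \<le> ?g i" for i
  proof -
    have "?g i - (coord (laplacian u) (i + 0))\<^sup>2 =
        2 * (coord u (i - 1) + coord u i)\<^sup>2 + 2 * (coord u (i + 1) + coord u i)\<^sup>2 +
        (coord u (i - 1) - coord u (i + 1))\<^sup>2"
      by (simp add: laplacian.rep_eq power2_eq_square algebra_simps)
    also have "\<dots> \<ge> 0" by simp
    finally show ?thesis by simp
  qed
  then have "(norm (laplacian u))\<^sup>2 \<le> 4 * S + 8 * S + 4 * S"
    by (intro has_sum_mono[OF norm_ell2_has_sum[where k = 0] g]) auto
  then show "(norm (laplacian u))\<^sup>2 \<le> (4 * norm u)\<^sup>2" by (simp add: S_def power_mult_distrib)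
qed simp

lemma nemytskii_zero: "F 0 = 0 \<Longrightarrow> nemytskii F 0 = 0"
  by (simp add: nemytskii_def zero_ell2.rep_eq) (simp add: zero_ell2_def)

lemma nemytskii_lipschitz:
  assumes "lipschitz_on_bounded_sets F" "F 0 = 0"
  shows "\<exists>L. L-lipschitz_on (cball 0 R) (nemytskii F)"
proof -
  obtain L where L: "L-lipschitz_on {-R..R} F"
    using assms(1) unfolding lipschitz_on_bounded_sets_def by (meson bounded_closed_interval)
  have L0: "L \<ge> 0" by (rule lipschitz_on_nonneg[OF L])
  have "L-lipschitz_on (cball 0 R) (nemytskii F)"
  proof (rule lipschitz_onI[OF _ L0])
    fix x y :: ell2 assume xy: "x \<in> cball 0 R" "y \<in> cball 0 R"
    have "(coord (nemytskii F x - nemytskii F y) i)\<^sup>2 \<le> L\<^sup>2 * (coord (x - y) i)\<^sup>2" for i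
    proof -
      have "coord x i \<in> {-R..R}" "coord y i \<in> {-R..R}"
        using abs_coord_le_norm[of x i] abs_coord_le_norm[of y i] xy by auto
      then have "\<bar>F (coord x i) - F (coord y i)\<bar> \<le> \<bar>L * (coord x i - coord y i)\<bar>"
        using lipschitz_onD[OF L, of "coord x i" "coord y i"] L0
        by (simp add: dist_real_def abs_mult)
      then have "(F (coord x i) - F (coord y i))\<^sup>2 \<le> (L * (coord x i - coord y i))\<^sup>2"
        by (simp only: abs_le_square_iff)
      then show ?thesis
        by (simp add: coord_diff coord_nemytskii[OF assms] power_mult_distrib)
    qed
    then have "(norm (nemytskii F x - nemytskii F y))\<^sup>2 \<le> L\<^sup>2 * (norm (x - y))\<^sup>2"
      by (rule norm_ell2_le_coordwise)
    then show "dist (nemytskii F x) (nemytskii F y) \<le> L * dist x y"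
      unfolding dist_norm power_mult_distrib[symmetric]
      by (rule power2_le_imp_le) (use L0 in simp)
  qed
  then show ?thesis by blast
qed

lemma inner_nemytskii_diff_nonpos:
  assumes "lipschitz_on_bounded_sets F" "F 0 = 0"
    and "\<And>a b. (a - b) * (F a - F b) \<le> 0"
  shows "inner (nemytskii F x - nemytskii F y) (x - y) \<le> 0"
proof (rule has_sum_mono[OF inner_ell2_has_sum has_sum_0])
  show "coord (nemytskii F x - nemytskii F y) i * coord (x - y) i \<le> 0" for i
    using assms(3)[of "coord x i" "coord y i"]
    by (simp add: coord_diff coord_nemytskii[OF assms(1,2)] mult.commute)
qed simp

text \<open>The linear damping supplies the rate \<open>lam\<close>; the Laplacian and the Nemytskii
  operator contribute nonpositive terms.\<close>

lemma lattice_dissipative_field: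
  assumes "\<nu> \<ge> 0" "lam > 0" "lipschitz_on_bounded_sets F" "F 0 = 0"
    and F: "\<And>a b. (a - b) * (F a - F b) \<le> 0"
  shows "dissipative_field (\<lambda>x. \<nu> *\<^sub>R laplacian x - lam *\<^sub>R x + nemytskii F x) lam"
proof
  fix R
  obtain L where L: "L-lipschitz_on (cball 0 R) (nemytskii F)"
    using nemytskii_lipschitz[OF assms(3,4)] by blast
  have "4-lipschitz_on (cball 0 R) laplacian"
    by (rule lipschitz_onI) (simp_all add: dist_norm norm_laplacian_le flip: laplacian_diff)
  from lipschitz_on_add[OF lipschitz_on_diff[OF lipschitz_on_cmult[OF this, of \<nu>]
        lipschitz_on_cmult[OF lipschitz_on_id, of lam]] L]
  show "\<exists>L. L-lipschitz_on (cball 0 R) (\<lambda>x. \<nu> *\<^sub>R laplacian x - lam *\<^sub>R x + nemytskii F x)"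
    by auto
next
  fix x y :: ell2
  have "inner ((\<nu> *\<^sub>R laplacian x - lam *\<^sub>R x + nemytskii F x) -
        (\<nu> *\<^sub>R laplacian y - lam *\<^sub>R y + nemytskii F y)) (x - y) =
      \<nu> * inner (laplacian (x - y)) (x - y) - lam * (norm (x - y))\<^sup>2 +
      inner (nemytskii F x - nemytskii F y) (x - y)"
    by (simp add: laplacian_diff power2_norm_eq_inner algebra_simps)
  also have "\<dots> \<le> 0 - lam * (norm (x - y))\<^sup>2 + 0"
    using assms(1) inner_laplacian_nonpos inner_nemytskii_diff_nonpos[OF assms(3-5)]
    by (intro add_mono diff_mono) (auto simp: mult_nonneg_nonpos)
  finally show "inner ((\<nu> *\<^sub>R laplacian x - lam *\<^sub>R x + nemytskii F x) -
      (\<nu> *\<^sub>R laplacian y - lam *\<^sub>R y + nemytskii F y)) (x - y) \<le> - lam * (norm (x - y))\<^sup>2"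
    by simp
next
  show "\<nu> *\<^sub>R laplacian 0 - lam *\<^sub>R 0 + nemytskii F 0 = 0"
    using laplacian_diff[of 0 0] by (simp add: nemytskii_zero[of F, OF assms(4)])
qed (rule assms(2))

section \<open>Poisson stable solutions\<close>

context dissipative_field
begin

lemma lagrange_stable_forcing:
  assumes "shift_system.lagrange_stable f"
  obtains u where "solution_on UNIV f u" "shift_system.uniformly_comparable f u"
proof -
  have f: "continuous_on UNIV f"
    using assms by (rule lagrange_stable_function_continuous)
  obtain C where "\<And>t. norm (f t) \<le> C" using lagrange_stable_function_bounded[OF assms] by blast
  then obtain u where u: "solution_on UNIV f u" "\<And>t. norm (u t) \<le> C / \<kappa>"
    using bounded_solution_exists[OF f] by blast
  have "shift_system.uniformly_comparable f u"
    unfolding shift_system.uniformly_comparable_def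
    using bounded_solution_comparable[OF u(1) f u(2)] f solution_on_continuous[OF u(1)]
    by (simp add: continuous_functions_def)
  then show ?thesis using that u(1) by blast
qed

text \<open>Lagrange stable functions are bounded, so uniqueness among bounded solutions
  applies.\<close>

lemma lagrange_stable_solution_unique:
  assumes "solution_on UNIV f u" "solution_on UNIV f v"
    and "shift_system.lagrange_stable u" "shift_system.lagrange_stable v"
  shows "u = v"
proof -
  obtain B1 B2 where "\<And>t. norm (u t) \<le> B1" "\<And>t. norm (v t) \<le> B2"
    using lagrange_stable_function_bounded assms(3,4) by metis
  then show ?thesis
    using bounded_solution_unique[OF assms(1,2), of "max B1 B2"] by (simp add: le_max_iff_disj)
qed

lemma solution_exponentially_stable:
  assumes f: "shift_system.lagrange_stable f" and u: "solution_on UNIV f u"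
  shows "\<exists>\<phi>. solution_on {0..} f \<phi> \<and> \<phi> 0 = v \<and>
    (\<forall>\<psi>. solution_on {0..} f \<psi> \<and> \<psi> 0 = v \<longrightarrow> (\<forall>t\<ge>0. \<psi> t = \<phi> t)) \<and>
    (\<forall>t\<ge>0. norm (\<phi> t - u t) \<le> exp (- (\<kappa> / 2) * t) * norm (v - u 0))"
proof -
  have "continuous_on UNIV f"
    using f by (rule lagrange_stable_function_continuous)
  then obtain \<phi> where \<phi>: "solution_on {0..} f \<phi>" "\<phi> 0 = v"
    using ivp_exists lagrange_stable_function_bounded[OF f] by metis
  have "norm (\<phi> t - u t) \<le> exp (- (\<kappa> / 2) * t) * norm (v - u 0)" if "t \<ge> 0" for t
  proof -
    have "solution_on {0..t} f \<phi>" "solution_on {0..t} f u"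
      by (auto intro: solution_on_subset[OF \<phi>(1)] solution_on_subset[OF u])
    from solution_contraction[OF this that] show ?thesis using \<phi>(2) by simp
  qed
  moreover have "\<psi> t = \<phi> t" if "solution_on {0..} f \<psi>" "\<psi> 0 = v" "t \<ge> 0" for \<psi> t
    using ivp_unique[OF that(1) \<phi>(1)] that \<phi>(2) by simp
  ultimately show ?thesis using \<phi> by blast
qed

end

theorem theorem8p8:
  fixes \<nu> lam \<alpha> :: real and F :: "real \<Rightarrow> real" and f :: "real \<Rightarrow> ell2"
  assumes "\<nu> > 0" "lam > 0" "\<alpha> \<ge> 0"
    and "continuous_on UNIV F" "lipschitz_on_bounded_sets F" "F 0 = 0"
    and "\<And>x1 x2. (x1 - x2) * (F x1 - F x2) \<le> - \<alpha> * \<bar>x1 - x2\<bar>\<^sup>2"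
    and "continuous_on UNIV f"
  shows "(almost_automorphic_function f \<longrightarrow>
      (\<exists>!u. lattice_solution \<nu> lam F f u \<and> almost_automorphic_function u) \<and>
      (\<forall>u. lattice_solution \<nu> lam F f u \<and> almost_automorphic_function u \<longrightarrow>
        globally_exponentially_stable \<nu> lam F f u)) \<and>
    (recurrent_function f \<longrightarrow>
      (\<exists>!u. lattice_solution \<nu> lam F f u \<and> recurrent_function u) \<and>
      (\<forall>u. lattice_solution \<nu> lam F f u \<and> recurrent_function u \<longrightarrow>
        globally_exponentially_stable \<nu> lam F f u))"
proof -
  interpret dissipative_field "\<lambda>x. \<nu> *\<^sub>R laplacian x - lam *\<^sub>R x + nemytskii F x" lam
  proof (rule lattice_dissipative_field)
    fix a b
    have "- \<alpha> * \<bar>a - b\<bar>\<^sup>2 \<le> 0" using assms(3) by simp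
    then show "(a - b) * (F a - F b) \<le> 0" using assms(7)[of a b] by linarith
  qed (use assms in auto)
  have sol: "lattice_solution_on I \<nu> lam F f u = solution_on I f u" for I u
    by (simp add: lattice_solution_on_def solution_on_def)
  have stable: "globally_exponentially_stable \<nu> lam F f u"
    if "shift_system.lagrange_stable f" "solution_on UNIV f u" for u
    unfolding globally_exponentially_stable_def sol
  proof (rule exI[of _ 1], rule conjI[OF zero_less_one], rule exI[of _ "lam / 2"], rule conjI)
    show "0 < lam / 2" using rate_pos by simp
  qed (unfold mult_1, use solution_exponentially_stable[OF that] in blast)
  \<comment> \<open>Both notions of the theorem are treated at once: \<open>P\<close> is any
    property that implies Lagrange stability and passes from \<open>f\<close> to functions
    comparable with it.\<close>
  have main: "(\<exists>!u. solution_on UNIV f u \<and> P u) \<and>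
      (\<forall>u. solution_on UNIV f u \<and> P u \<longrightarrow> globally_exponentially_stable \<nu> lam F f u)"
    if P: "P f" and stab: "\<And>g. P g \<Longrightarrow> shift_system.lagrange_stable g"
      and comp: "\<And>u. shift_system.uniformly_comparable f u \<Longrightarrow> P f \<Longrightarrow> P u"
    for P :: "(real \<Rightarrow> ell2) \<Rightarrow> bool"
  proof -
    obtain u where "solution_on UNIV f u" "shift_system.uniformly_comparable f u"
      using lagrange_stable_forcing[OF stab[OF P]] by blast
    then show ?thesis
      using comp[OF _ P] lagrange_stable_solution_unique stab stable[OF stab[OF P]] by blast
  qed
  show ?thesis
    unfolding sol
    using main[of shift_system.almost_automorphic] main[of shift_system.recurrent]
      shift_system.comparable_almost_automorphic shift_system.comparable_recurrent
    unfolding shift_system.almost_automorphic_def[of _] shift_system.recurrent_def[of _] by blast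
qed

end
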